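(* Let $G$ be a finite group, $p$ a prime dividing $|G|$, $P\in\mathrm{Syl}_p(G)$ and $\Omega=\Omega_1(Z(P))$. If $r_p(G)-r_p(\Omega)\le2$ and $r_p(G)\ge\log_p(|P|)-1$, then $\mathcal{A}_p(G)'/G$ is a contractible finite space.
   Context: $\Omega_1(H)$ is the subgroup generated by the elements of order $p$ of $H$; $r_p(H)$ is the largest $r$ such that $H$ has an elementary abelian subgroup of order $p^r$. $\mathcal{A}_p(G)$ is the poset of non-trivial elementary abelian $p$-subgroups of $G$, with $G$ acting by conjugation; $\mathcal{A}_p(G)'$ is its poset of non-empty chains ordered by inclusion, with componentwise action; $\mathcal{A}_p(G)'/G$ is the orbit poset ($\overline{c}\le\overline{d}$ iff some representatives satisfy $c_1\subseteq d_1$), regarded as a finite $T_0$ space whose open sets are the down-sets. *)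

theory Defs
  imports "HOL-Analysis.Analysis" "HOL-Algebra.Multiplicative_Group" "HOL-Algebra.Generated_Groups"
begin

definition sylow_subgroup :: "('a, 'b) monoid_scheme \<Rightarrow> nat \<Rightarrow> 'a set \<Rightarrow> bool" where
  "sylow_subgroup G p P \<longleftrightarrow> subgroup P G \<and> card P = p ^ multiplicity p (order G)"

definition centre_of :: "('a, 'b) monoid_scheme \<Rightarrow> 'a set \<Rightarrow> 'a set" where
  "centre_of G H = {x \<in> H. \<forall>y \<in> H. x \<otimes>\<^bsub>G\<^esub> y = y \<otimes>\<^bsub>G\<^esub> x}"

definition Omega1 :: "('a, 'b) monoid_scheme \<Rightarrow> nat \<Rightarrow> 'a set \<Rightarrow> 'a set" where
  "Omega1 G p H = generate G {x \<in> H. group.ord G x = p}"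

definition elem_abelian :: "('a, 'b) monoid_scheme \<Rightarrow> nat \<Rightarrow> 'a set \<Rightarrow> bool" where
  "elem_abelian G p E \<longleftrightarrow> subgroup E G
     \<and> (\<forall>x \<in> E. \<forall>y \<in> E. x \<otimes>\<^bsub>G\<^esub> y = y \<otimes>\<^bsub>G\<^esub> x)
     \<and> (\<forall>x \<in> E. x [^]\<^bsub>G\<^esub> p = \<one>\<^bsub>G\<^esub>)"

definition p_rank :: "('a, 'b) monoid_scheme \<Rightarrow> nat \<Rightarrow> 'a set \<Rightarrow> nat" where
  "p_rank G p H = Max {r. \<exists>E. E \<subseteq> H \<and> elem_abelian G p E \<and> card E = p ^ r}"

definition Ap :: "('a, 'b) monoid_scheme \<Rightarrow> nat \<Rightarrow> 'a set set" where
  "Ap G p = {E. elem_abelian G p E \<and> E \<noteq> {\<one>\<^bsub>G\<^esub>}}"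

definition Ap_chains :: "('a, 'b) monoid_scheme \<Rightarrow> nat \<Rightarrow> 'a set set set" where
  "Ap_chains G p = {c. c \<noteq> {} \<and> finite c \<and> c \<subseteq> Ap G p
      \<and> (\<forall>E \<in> c. \<forall>F \<in> c. E \<subseteq> F \<or> F \<subseteq> E)}"

definition conj_set :: "('a, 'b) monoid_scheme \<Rightarrow> 'a \<Rightarrow> 'a set \<Rightarrow> 'a set" where
  "conj_set G g E = (\<lambda>x. g \<otimes>\<^bsub>G\<^esub> x \<otimes>\<^bsub>G\<^esub> inv\<^bsub>G\<^esub> g) ` E"

definition conj_chain :: "('a, 'b) monoid_scheme \<Rightarrow> 'a \<Rightarrow> 'a set set \<Rightarrow> 'a set set" where
  "conj_chain G g c = conj_set G g ` c"

definition chain_orbits :: "('a, 'b) monoid_scheme \<Rightarrow> nat \<Rightarrow> 'a set set set set" where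
  "chain_orbits G p = (\<lambda>c. (\<lambda>g. conj_chain G g c) ` carrier G) ` Ap_chains G p"

definition orbit_le :: "'a set set set \<Rightarrow> 'a set set set \<Rightarrow> bool" where
  "orbit_le O1 O2 \<longleftrightarrow> (\<exists>c \<in> O1. \<exists>d \<in> O2. c \<subseteq> d)"

text \<open>The finite T0 space associated to the orbit poset: open sets are the down-sets.\<close>
definition orbit_space :: "('a, 'b) monoid_scheme \<Rightarrow> nat \<Rightarrow> 'a set set set topology" where
  "orbit_space G p = topology (\<lambda>U. U \<subseteq> chain_orbits G p
      \<and> (\<forall>a \<in> U. \<forall>b \<in> chain_orbits G p. orbit_le b a \<longrightarrow> b \<in> U))"

end

theory Submission
  imports Defs "HOL-Algebra.Sylow" "HOL-Algebra.Group_Action"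
begin

text \<open>
  By the hypothesis on the rank, every Sylow p-subgroup \<open>T\<close> of \<open>G\<close> has an elementary abelian subgroup of
  index at most \<open>p\<close>. This has two consequences. First, a Sylow p-subgroup of the centralizer of an
  elementary abelian \<open>E\<close> is either a Sylow subgroup of \<open>G\<close> (call \<open>E\<close> full) or elementary abelian.
  Second, if \<open>M < T\<close> is elementary abelian and is a Sylow subgroup of its centralizer, then the centre of
  \<open>N\<^sub>T(M)\<close> is \<open>\<Omega>\<^sub>1(Z(T))\<close>.

  For a chain \<open>c\<close> choose a Sylow subgroup \<open>S\<close> of its centralizer and a Sylow subgroup \<open>T \<supseteq> S\<close> of \<open>G\<close> that
  centralizes the full members of \<open>c\<close>. If the top of \<open>c\<close> is not full, put \<open>S\<close> on top of \<open>c\<close>, then discard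
  all the non-full members except \<open>S\<close>. In either case finally insert \<open>\<Omega>\<^sub>1(Z(T))\<close>, which lies above all the
  full members and below \<open>S\<close>. Each of these steps defines a monotone self-map of the orbit poset that is
  comparable to the preceding one, and the last map is bounded below by the constant map at the orbit of
  \<open>{\<Omega>\<^sub>1(Z(P))}\<close>. Comparable monotone maps are homotopic.

  That the last step is well defined on orbits is the second consequence: Sylow subgroups of
  \<open>C(c\<^sub>0) \<inter> N(S)\<close>, where \<open>c\<^sub>0\<close> is the full part of \<open>c\<close>, are conjugate, and \<open>\<Omega>\<^sub>1(Z(T))\<close> is the centre of
  one of them.
\<close>

section \<open>Spaces of down-sets\<close>

text \<open>The topology of \<open>orbit_space\<close> for an arbitrary set and relation, so that
  homotopies of monotone maps can be treated apart from groups.\<close>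

definition downset_space :: "'a set \<Rightarrow> ('a \<Rightarrow> 'a \<Rightarrow> bool) \<Rightarrow> 'a topology" where
  "downset_space X r = topology (\<lambda>U. U \<subseteq> X \<and> (\<forall>a\<in>U. \<forall>b\<in>X. r b a \<longrightarrow> b \<in> U))"

definition mono_map :: "'a set \<Rightarrow> ('a \<Rightarrow> 'a \<Rightarrow> bool) \<Rightarrow> ('a \<Rightarrow> 'a) \<Rightarrow> bool" where
  "mono_map X r f \<longleftrightarrow> f \<in> X \<rightarrow> X \<and> (\<forall>x\<in>X. \<forall>y\<in>X. r x y \<longrightarrow> r (f x) (f y))"

lemma openin_downset_space:
  "openin (downset_space X r) U \<longleftrightarrow> U \<subseteq> X \<and> (\<forall>a\<in>U. \<forall>b\<in>X. r b a \<longrightarrow> b \<in> U)"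
proof -
  have "istopology (\<lambda>U. U \<subseteq> X \<and> (\<forall>a\<in>U. \<forall>b\<in>X. r b a \<longrightarrow> b \<in> U))"
    unfolding istopology_def by blast
  then show ?thesis
    by (simp add: downset_space_def topology_inverse')
qed

lemma topspace_downset_space: "topspace (downset_space X r) = X"
  unfolding topspace_def openin_downset_space by blast
  

text \<open>The homotopy stays at \<open>f\<close> for \<open>t < 1\<close> and jumps to
  \<open>g\<close> at \<open>t = 1\<close>. It is continuous because \<open>U\<close> is a down-set:
  \<open>g x\<close> in \<open>U\<close> forces \<open>f x\<close> in \<open>U\<close>, so the
  preimage of \<open>U\<close> is the union of two open boxes, \<open>[0,1)\<close> times the
  preimage under \<open>f\<close> and \<open>[0,1]\<close> times the preimage under
  \<open>g\<close>.\<close>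

lemma mono_maps_homotopic:
  assumes f: "mono_map X r f" and g: "mono_map X r g"
    and fg: "\<And>x. x \<in> X \<Longrightarrow> r (f x) (g x)"
  shows "homotopic_with (\<lambda>_. True) (downset_space X r) (downset_space X r) f g"
  unfolding homotopic_with_def
proof (intro exI conjI allI ballI)
  let ?T = "downset_space X r"
  let ?I = "top_of_set {0..1::real}"
  let ?h = "\<lambda>(t::real, x). if t = 1 then g x else f x"
  have pre: "openin ?T {x \<in> X. k x \<in> U}" if "openin ?T U" "mono_map X r k" for U k
    using that unfolding openin_downset_space mono_map_def by blast
  show "continuous_map (prod_topology ?I ?T) ?T ?h"
    unfolding continuous_map_def
  proof (intro conjI allI impI)
    show "?h \<in> topspace (prod_topology ?I ?T) \<rightarrow> topspace ?T"
      using f g by (auto simp: topspace_downset_space mono_map_def)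
    fix U assume U: "openin ?T U"
    have gf: "f x \<in> U" if "x \<in> X" "g x \<in> U" for x
      using that fg U f unfolding openin_downset_space mono_map_def by blast
    have "{z \<in> topspace (prod_topology ?I ?T). ?h z \<in> U}
       = {0..<1} \<times> {x \<in> X. f x \<in> U} \<union> {0..1} \<times> {x \<in> X. g x \<in> U}"
      using gf by (auto simp: topspace_downset_space split: if_splits)
    moreover have "openin ?I {0..<1}"
    proof -
      have "{0..<1::real} = {0..1} \<inter> {..<1}" by auto
      then show ?thesis by (metis open_lessThan openin_open_Int)
    qed
    ultimately show "openin (prod_topology ?I ?T) {z \<in> topspace (prod_topology ?I ?T). ?h z \<in> U}"
      using pre[OF U f] pre[OF U g]
      by (simp add: openin_Un openin_prod_Times_iff)
  qed
qed auto

section \<open>Fixed points of actions of p-groups\<close>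

text \<open>A \<open>group_action\<close> is a homomorphism into \<open>BijGroup E\<close>, whose
  elements are extensional functions; hence the restriction to \<open>E\<close>. The action of
  \<open>inv g\<close> inverts that of \<open>g\<close>.\<close>

lemma (in group) group_action_restrictI:
  assumes cl: "\<And>g x. g \<in> carrier G \<Longrightarrow> x \<in> E \<Longrightarrow> act g x \<in> E"
    and one: "\<And>x. x \<in> E \<Longrightarrow> act \<one> x = x"
    and mult: "\<And>g h x. g \<in> carrier G \<Longrightarrow> h \<in> carrier G \<Longrightarrow> x \<in> E \<Longrightarrow> act (g \<otimes> h) x = act g (act h x)"
  shows "group_action G E (\<lambda>g. \<lambda>x\<in>E. act g x)"
proof -
  let ?phi = "\<lambda>g. \<lambda>x\<in>E. act g x"
  have bij: "?phi g \<in> Bij E" if g: "g \<in> carrier G" for g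
  proof -
    have "bij_betw (?phi g) E E"
      by (rule bij_betw_byWitness[where f' = "?phi (inv g)"])
        (use g cl mult[OF g inv_closed[OF g]] mult[OF inv_closed[OF g] g] one in auto)
    then show ?thesis by (simp add: Bij_def)
  qed
  have "?phi \<in> hom G (BijGroup E)"
  proof (rule homI)
    show "?phi g \<in> carrier (BijGroup E)" if "g \<in> carrier G" for g
      using bij[OF that] by (simp add: BijGroup_def)
    show "?phi (g \<otimes> h) = ?phi g \<otimes>\<^bsub>BijGroup E\<^esub> ?phi h" if "g \<in> carrier G" "h \<in> carrier G" for g h
      using that bij cl mult by (auto simp: BijGroup_def compose_def fun_eq_iff)
  qed
  then show ?thesis
    by (simp add: group_action_def group_hom_def group_hom_axioms_def group_BijGroup is_group)
qed

lemma (in group_action) orbit_singleton_iff: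
  assumes "x \<in> E"
  shows "orbit G \<phi> x = {x} \<longleftrightarrow> (\<forall>g\<in>carrier G. \<phi> g x = x)"
  using orbit_refl[OF assms] unfolding orbit_def by auto

text \<open>By orbit-stabilizer every orbit has \<open>p ^ i\<close> elements, and
  \<open>i > 0\<close> unless the orbit is a fixed point. So \<open>card E\<close> and the number of
  fixed points agree modulo \<open>p\<close>.\<close>

lemma (in group_action) card_fixed_points_mod_prime:
  assumes p: "prime p" and ord: "order G = p ^ k" and fin: "finite E"
  shows "p dvd card E \<longleftrightarrow> p dvd card {x \<in> E. \<forall>g\<in>carrier G. \<phi> g x = x}"
proof -
  let ?F = "{x \<in> E. \<forall>g\<in>carrier G. \<phi> g x = x}"
  let ?O = "orbits G E \<phi>"
  have finO: "finite ?O" using fin by (simp add: orbits_def)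
  let ?O1 = "(\<lambda>x. {x}) ` ?F"
  have O1: "?O1 \<subseteq> ?O"
    using orbit_singleton_iff by (fastforce simp: orbits_def)
  have E: "card E = (\<Sum>w\<in>?O. card w)"
  proof -
    have "(\<Sum>w\<in>?O. card w) = (\<Sum>w\<in>?O. \<Sum>x\<in>w. 1)" by simp
    then show ?thesis using disjoint_sum[OF fin, of "\<lambda>_. 1::nat"] by simp
  qed
  have split: "card E = (\<Sum>w\<in>?O - ?O1. card w) + (\<Sum>w\<in>?O1. card w)"
    unfolding E using sum.subset_diff[OF O1 finO] .
  have "(\<Sum>w\<in>?O1. card w) = card ?F"
    by (subst sum.reindex) (auto simp: inj_on_def)
  moreover have "p dvd (\<Sum>w\<in>?O - ?O1. card w)"
  proof (rule dvd_sum)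
    fix o' assume o': "o' \<in> ?O - ?O1"
    then obtain x where x: "x \<in> E" "o' = orbit G \<phi> x" by (auto simp: orbits_def)
    have "card o' dvd p ^ k"
      using orbit_stabilizer_theorem[OF x(1)] x(2) ord by (metis dvd_triv_left)
    then obtain i where i: "card o' = p ^ i"
      using p by (auto simp: divides_primepow_nat)
    have "i \<noteq> 0"
    proof
      assume "i = 0"
      then obtain y where "o' = {y}" using i by (auto simp: card_1_singleton_iff)
      then have "orbit G \<phi> x = {x}" using orbit_refl[OF x(1)] x(2) by auto
      then have "o' \<in> ?O1" using orbit_singleton_iff x by auto
      then show False using o' by blast
    qed
    then show "p dvd card o'" using i by simp
  qed
  ultimately show ?thesis
    unfolding split by (simp add: dvd_add_right_iff)
qed

lemma (in group) card_fixed_points_mod_prime: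
  assumes "\<And>g x. g \<in> carrier G \<Longrightarrow> x \<in> E \<Longrightarrow> act g x \<in> E"
    and "\<And>x. x \<in> E \<Longrightarrow> act \<one> x = x"
    and "\<And>g h x. g \<in> carrier G \<Longrightarrow> h \<in> carrier G \<Longrightarrow> x \<in> E \<Longrightarrow> act (g \<otimes> h) x = act g (act h x)"
    and "prime p" "order G = p ^ k" "finite E"
  shows "p dvd card E \<longleftrightarrow> p dvd card {x \<in> E. \<forall>g\<in>carrier G. act g x = x}"
proof -
  interpret A: group_action G E "\<lambda>g. \<lambda>x\<in>E. act g x"
    by (rule group_action_restrictI) (use assms in auto)
  have "{x \<in> E. \<forall>g\<in>carrier G. (\<lambda>x\<in>E. act g x) x = x} = {x \<in> E. \<forall>g\<in>carrier G. act g x = x}"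
    by auto
  then show ?thesis
    using A.card_fixed_points_mod_prime[OF assms(4-6)] by simp
qed

text \<open>\<open>Q\<close> acts on the right cosets of \<open>H\<close>, and a coset \<open>Hx\<close> is fixed iff \<open>x\<close> conjugates \<open>Q\<close> into \<open>H\<close>.\<close>

lemma (in group) card_fixed_cosets_mod_prime:
  assumes H: "subgroup H G" and Q: "subgroup Q G" and p: "prime p" "card Q = p ^ k"
    and fin: "finite (carrier G)"
  shows "p dvd card (rcosets H) \<longleftrightarrow>
    p dvd card {R \<in> rcosets H. \<exists>x\<in>carrier G. R = H #> x \<and> conj_set G x Q \<subseteq> H}"
proof -
  interpret QG: group "G\<lparr>carrier := Q\<rparr>" by (rule subgroup.subgroup_is_group[OF Q is_group])
  have Hc: "H \<subseteq> carrier G" and Qc: "Q \<subseteq> carrier G"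
    using H Q subgroup.subset by auto
  \<comment> \<open>\<open>q\<close> acts by right multiplication with \<open>inv q\<close>; the
    inverse turns this into a left action.\<close>
  have fix_iff: "(\<forall>q\<in>Q. (H #> x) #> inv q = H #> x) \<longleftrightarrow> conj_set G x Q \<subseteq> H" if x: "x \<in> carrier G" for x
  proof -
    have "(H #> x) #> inv q = H #> x \<longleftrightarrow> x \<otimes> q \<otimes> inv x \<in> H" if q: "q \<in> Q" for q
    proof -
      have q': "q \<in> carrier G" using q Qc by auto
      have "(H #> x) #> inv q = H #> x \<longleftrightarrow> H #> (x \<otimes> inv q) = H #> x"
        using coset_mult_assoc[OF Hc x] q' by simp
      also have "\<dots> \<longleftrightarrow> H #> (x \<otimes> q \<otimes> inv x) = H"
      proof
        assume "H #> (x \<otimes> inv q) = H #> x"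
        then have "H #> x = H #> (x \<otimes> inv q)" ..
        from coset_mult_inv2[OF this] show "H #> (x \<otimes> q \<otimes> inv x) = H"
          using x q' Hc by (simp add: inv_mult_group m_assoc)
      next
        assume "H #> (x \<otimes> q \<otimes> inv x) = H"
        then have "H #> x = H #> (x \<otimes> inv q)"
          using x q' Hc by (intro coset_mult_inv1) (simp_all add: inv_mult_group m_assoc)
        then show "H #> (x \<otimes> inv q) = H #> x" ..
      qed
      also have "\<dots> \<longleftrightarrow> x \<otimes> q \<otimes> inv x \<in> H"
        using x q' H by (meson coset_join1 coset_join2 inv_closed m_closed)
      finally show ?thesis .
    qed
    then show ?thesis by (auto simp: conj_set_def)
  qed
  have "p dvd card (rcosets H) \<longleftrightarrow>
    p dvd card {R \<in> rcosets H. \<forall>g\<in>carrier (G\<lparr>carrier := Q\<rparr>). R #> inv g = R}"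
  proof (rule QG.card_fixed_points_mod_prime)
    show "R #> inv g \<in> rcosets H" if "g \<in> carrier (G\<lparr>carrier := Q\<rparr>)" "R \<in> rcosets H" for g R
      using that Qc Hc by (auto simp: RCOSETS_def coset_mult_assoc subset_iff)
    show "R #> inv \<one>\<^bsub>G\<lparr>carrier := Q\<rparr>\<^esub> = R" if "R \<in> rcosets H" for R
      using that Hc by (auto simp: RCOSETS_def coset_mult_assoc)
    show "R #> inv (g \<otimes>\<^bsub>G\<lparr>carrier := Q\<rparr>\<^esub> h) = R #> inv h #> inv g"
      if "g \<in> carrier (G\<lparr>carrier := Q\<rparr>)" "h \<in> carrier (G\<lparr>carrier := Q\<rparr>)" "R \<in> rcosets H" for g h R
      using that Hc Qc by (auto simp: RCOSETS_def coset_mult_assoc inv_mult_group m_assoc subset_iff)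
    show "finite (rcosets H)" using fin by (simp add: RCOSETS_def)
  qed (use p in \<open>auto simp: order_def\<close>)
  also have "{R \<in> rcosets H. \<forall>g\<in>carrier (G\<lparr>carrier := Q\<rparr>). R #> inv g = R}
     = {R \<in> rcosets H. \<exists>x\<in>carrier G. R = H #> x \<and> conj_set G x Q \<subseteq> H}" (is "{R \<in> _. ?A R} = {R \<in> _. ?B R}")
  proof -
    have "?A R \<longleftrightarrow> ?B R" if R: "R \<in> rcosets H" for R
    proof -
      obtain x where x: "x \<in> carrier G" "R = H #> x" using R by (auto simp: RCOSETS_def)
      \<comment> \<open>The criterion holds for every representative of a coset, so the existential
        in \<open>?B\<close> does not depend on which one is taken.\<close>
      have "?A (H #> y) \<longleftrightarrow> conj_set G y Q \<subseteq> H" if "y \<in> carrier G" for y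
        using fix_iff[OF that] by simp
      then show ?thesis using x by blast
    qed
    then show ?thesis by blast
  qed
  finally show ?thesis .
qed

section \<open>Conjugation and centralizers\<close>

text \<open>Defined for arbitrary subsets. The centralizer of the empty set is the whole group,
  which is the case of a chain without full members.\<close>

definition centr :: "('a, 'b) monoid_scheme \<Rightarrow> 'a set \<Rightarrow> 'a set" where
  "centr G X = {g \<in> carrier G. \<forall>x\<in>X. g \<otimes>\<^bsub>G\<^esub> x = x \<otimes>\<^bsub>G\<^esub> g}"

definition normz :: "('a, 'b) monoid_scheme \<Rightarrow> 'a set \<Rightarrow> 'a set" where
  "normz G M = {g \<in> carrier G. conj_set G g M = M}"

lemma conj_set_mono: "A \<subseteq> B \<Longrightarrow> conj_set G g A \<subseteq> conj_set G g B"
  by (auto simp: conj_set_def)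

lemma centr_antimono: "X \<subseteq> Y \<Longrightarrow> centr G Y \<subseteq> centr G X"
  by (auto simp: centr_def)

lemma centr_subset_carrier: "centr G X \<subseteq> carrier G"
  by (auto simp: centr_def)

lemma elem_abelian_subset: "elem_abelian G p E \<Longrightarrow> F \<subseteq> E \<Longrightarrow> subgroup F G \<Longrightarrow> elem_abelian G p F"
  by (auto simp: elem_abelian_def subset_iff)

context group
begin

lemma conj_set_conj_set:
  "g \<in> carrier G \<Longrightarrow> h \<in> carrier G \<Longrightarrow> E \<subseteq> carrier G \<Longrightarrow>
    conj_set G g (conj_set G h E) = conj_set G (g \<otimes> h) E"
  unfolding conj_set_def image_image
  by (rule image_cong) (auto simp: m_assoc inv_mult_group subset_iff)

lemma conj_set_one: "E \<subseteq> carrier G \<Longrightarrow> conj_set G \<one> E = E"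
  by (force simp: conj_set_def)

lemma conj_set_closed: "g \<in> carrier G \<Longrightarrow> E \<subseteq> carrier G \<Longrightarrow> conj_set G g E \<subseteq> carrier G"
  by (auto simp: conj_set_def subset_iff)

lemma conj_set_inv:
  assumes "g \<in> carrier G" "E \<subseteq> carrier G"
  shows "conj_set G (inv g) (conj_set G g E) = E" "conj_set G g (conj_set G (inv g) E) = E"
  using assms by (simp_all add: conj_set_conj_set conj_set_one)

lemma conj_set_subset_iff:
  assumes "g \<in> carrier G" "E \<subseteq> carrier G" "F \<subseteq> carrier G"
  shows "conj_set G g E \<subseteq> F \<longleftrightarrow> E \<subseteq> conj_set G (inv g) F"
  using assms by (metis conj_set_inv conj_set_mono)

lemma inj_on_conj: "g \<in> carrier G \<Longrightarrow> inj_on (\<lambda>x. g \<otimes> x \<otimes> inv g) (carrier G)"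
  by (auto simp: inj_on_def)

lemma card_conj_set: "g \<in> carrier G \<Longrightarrow> E \<subseteq> carrier G \<Longrightarrow> card (conj_set G g E) = card E"
  unfolding conj_set_def by (rule card_image) (rule inj_on_subset[OF inj_on_conj])

lemma conj_mult:
  "g \<in> carrier G \<Longrightarrow> x \<in> carrier G \<Longrightarrow> y \<in> carrier G \<Longrightarrow>
    (g \<otimes> x \<otimes> inv g) \<otimes> (g \<otimes> y \<otimes> inv g) = g \<otimes> (x \<otimes> y) \<otimes> inv g"
  by (metis inv_closed inv_solve_left m_assoc m_closed)

lemma conj_pow:
  "g \<in> carrier G \<Longrightarrow> x \<in> carrier G \<Longrightarrow> (g \<otimes> x \<otimes> inv g) [^] (n::nat) = g \<otimes> (x [^] n) \<otimes> inv g"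
  by (induction n) (simp_all add: conj_mult)

lemma conj_eq_iff:
  "g \<in> carrier G \<Longrightarrow> x \<in> carrier G \<Longrightarrow> y \<in> carrier G \<Longrightarrow> g \<otimes> x \<otimes> inv g = g \<otimes> y \<otimes> inv g \<longleftrightarrow> x = y"
  by simp

lemma subgroup_pow_closed: "subgroup H G \<Longrightarrow> x \<in> H \<Longrightarrow> x [^] (n::nat) \<in> H"
  by (induction n) (simp_all add: subgroup.one_closed subgroup.m_closed)

lemma subgroup_conj_set:
  assumes g: "g \<in> carrier G" and E: "subgroup E G"
  shows "subgroup (conj_set G g E) G"
proof (rule subgroupI)
  have Ec: "E \<subseteq> carrier G" using E subgroup.subset by auto
  show "conj_set G g E \<subseteq> carrier G" by (rule conj_set_closed[OF g Ec])
  show "conj_set G g E \<noteq> {}" using subgroup.one_closed[OF E] by (auto simp: conj_set_def)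
  fix a b assume "a \<in> conj_set G g E" "b \<in> conj_set G g E"
  then obtain x y where xy: "x \<in> E" "y \<in> E" "a = g \<otimes> x \<otimes> inv g" "b = g \<otimes> y \<otimes> inv g"
    by (auto simp: conj_set_def)
  then have c: "x \<in> carrier G" "y \<in> carrier G" using Ec by auto
  have "inv a = g \<otimes> inv x \<otimes> inv g"
    using xy c g by (simp add: inv_mult_group m_assoc)
  then show "inv a \<in> conj_set G g E"
    using xy subgroup.m_inv_closed[OF E] by (auto simp: conj_set_def)
  show "a \<otimes> b \<in> conj_set G g E"
    using xy c g conj_mult subgroup.m_closed[OF E] by (auto simp: conj_set_def)
qed

lemma elem_abelian_conj_set:
  assumes g: "g \<in> carrier G" and E: "elem_abelian G p E"
  shows "elem_abelian G p (conj_set G g E)"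
proof -
  have sE: "subgroup E G" and Ec: "E \<subseteq> carrier G" using E subgroup.subset by (auto simp: elem_abelian_def)
  have "subgroup (conj_set G g E) G" by (rule subgroup_conj_set[OF g sE])
  moreover have "(g \<otimes> x \<otimes> inv g) \<otimes> (g \<otimes> y \<otimes> inv g) = (g \<otimes> y \<otimes> inv g) \<otimes> (g \<otimes> x \<otimes> inv g)"
    if "x \<in> E" "y \<in> E" for x y
    using that E Ec g by (simp add: conj_mult elem_abelian_def subset_iff)
  moreover have "(g \<otimes> x \<otimes> inv g) [^] p = \<one>" if "x \<in> E" for x
    using that E Ec g by (simp add: conj_pow elem_abelian_def subset_iff)
  ultimately show ?thesis
    unfolding elem_abelian_def conj_set_def by blast
qed

lemma subgroup_centr: "X \<subseteq> carrier G \<Longrightarrow> subgroup (centr G X) G"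
proof (rule subgroupI)
  assume X: "X \<subseteq> carrier G"
  show "centr G X \<subseteq> carrier G" by (auto simp: centr_def)
  have "\<one> \<in> centr G X" using X by (auto simp: centr_def)
  then show "centr G X \<noteq> {}" by blast
  fix a b assume a: "a \<in> centr G X" and b: "b \<in> centr G X"
  show "inv a \<in> centr G X"
  proof -
    have ac: "a \<in> carrier G" using a by (auto simp: centr_def)
    have "inv a \<otimes> x = x \<otimes> inv a" if "x \<in> X" for x
    proof -
      have xc: "x \<in> carrier G" using that X by auto
      have "inv a \<otimes> x = inv a \<otimes> (x \<otimes> a) \<otimes> inv a" using ac xc by (simp add: m_assoc)
      also have "x \<otimes> a = a \<otimes> x" using a that by (auto simp: centr_def)
      also have "inv a \<otimes> (a \<otimes> x) \<otimes> inv a = x \<otimes> inv a" using ac xc by (simp add: m_assoc[symmetric])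
      finally show ?thesis .
    qed
    then show ?thesis using ac by (auto simp: centr_def)
  qed
  show "a \<otimes> b \<in> centr G X"
    using a b X by (auto simp: centr_def subset_iff) (metis m_assoc)
qed

lemma subgroup_normz:
  assumes "M \<subseteq> carrier G" shows "subgroup (normz G M) G"
proof (rule subgroupI)
  show "normz G M \<subseteq> carrier G" by (auto simp: normz_def)
  have "\<one> \<in> normz G M" using assms by (auto simp: normz_def conj_set_one)
  then show "normz G M \<noteq> {}" by blast
  fix a b assume a: "a \<in> normz G M" and b: "b \<in> normz G M"
  show "inv a \<in> normz G M"
    using a assms conj_set_inv(1)[of a M] by (auto simp: normz_def)
  show "a \<otimes> b \<in> normz G M"
    using a b assms conj_set_conj_set[of a b M] by (auto simp: normz_def)
qed

lemma conj_set_centr_id: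
  assumes "h \<in> centr G X" "X \<subseteq> carrier G" shows "conj_set G h X = X"
proof -
  have "h \<otimes> x \<otimes> inv h = x" if "x \<in> X" for x
    using that assms by (auto simp: centr_def subset_iff inv_solve_right')
  then show ?thesis by (force simp: conj_set_def)
qed

text \<open>Closure gives one inclusion; the same inclusion for \<open>inv h\<close> gives the
  other.\<close>

lemma conj_set_subgroup_id:
  assumes H: "subgroup H G" and h: "h \<in> H"
  shows "conj_set G h H = H"
proof -
  have Hc: "H \<subseteq> carrier G" using H subgroup.subset by auto
  have *: "conj_set G x H \<subseteq> H" if "x \<in> H" for x
    using that H by (auto simp: conj_set_def subgroup.m_closed subgroup.m_inv_closed)
  have "H \<subseteq> conj_set G h H"
    using *[of "inv h"] conj_set_subset_iff[of "inv h" H H] H h Hc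
    by (auto simp: subgroup.m_inv_closed subset_iff)
  then show ?thesis using *[OF h] by blast
qed

lemma subgroup_subset_normz: "subgroup H G \<Longrightarrow> H \<subseteq> normz G H"
  using conj_set_subgroup_id subgroup.mem_carrier by (fastforce simp: normz_def)

text \<open>The inclusion from right to left holds for all conjugating elements and all sets.
  Applied to \<open>inv g\<close> and the conjugate of \<open>X\<close>, it yields the reverse
  inclusion.\<close>

lemma centr_conj_set:
  assumes g: "g \<in> carrier G" and X: "X \<subseteq> carrier G"
  shows "centr G (conj_set G g X) = conj_set G g (centr G X)"
proof -
  have sub: "conj_set G h (centr G Y) \<subseteq> centr G (conj_set G h Y)" if "h \<in> carrier G" "Y \<subseteq> carrier G" for h Y
    using that by (auto simp: conj_set_def centr_def conj_mult subset_iff)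
  have "centr G (conj_set G g X) \<subseteq> conj_set G g (centr G X)"
    using sub[of "inv g" "conj_set G g X"] g X
      conj_set_subset_iff[of "inv g" "centr G (conj_set G g X)" "centr G X"]
    by (simp add: conj_set_inv conj_set_closed centr_subset_carrier)
  then show ?thesis using sub[OF g X] by blast
qed

end

section \<open>Maximal p-subgroups\<close>

locale finite_group_prime = group G for G :: "('a, 'b) monoid_scheme" (structure) +
  fixes p :: nat
  assumes fin: "finite (carrier G)" and p: "prime p"
begin

definition psub :: "'a set \<Rightarrow> bool" where
  "psub Q \<longleftrightarrow> subgroup Q G \<and> (\<exists>k. card Q = p ^ k)"

text \<open>For a subgroup \<open>H\<close> these are the Sylow p-subgroups of \<open>H\<close>.
  Maximality under inclusion replaces the usual condition on the order: existence above a given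
  p-subgroup and passage to intermediate subgroups become immediate, and conjugacy is recovered in
  \<open>maxp_conj\<close>.\<close>

definition maxp :: "'a set \<Rightarrow> 'a set \<Rightarrow> bool" where
  "maxp H S \<longleftrightarrow> S \<subseteq> H \<and> psub S \<and> (\<forall>Q. psub Q \<longrightarrow> S \<subseteq> Q \<longrightarrow> Q \<subseteq> H \<longrightarrow> Q = S)"

lemma psub_subgroup: "psub Q \<Longrightarrow> subgroup Q G"
  by (simp add: psub_def)

lemma psub_carrier: "psub Q \<Longrightarrow> Q \<subseteq> carrier G"
  by (simp add: psub_def subgroup.subset)

lemma psub_finite: "psub Q \<Longrightarrow> finite Q"
  using fin finite_subset psub_carrier by blast

lemma subgroup_card_dvd: "subgroup H G \<Longrightarrow> subgroup K G \<Longrightarrow> H \<subseteq> K \<Longrightarrow> card H dvd card K"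
  using group.lagrange[of "G\<lparr>carrier := K\<rparr>" H] subgroup.subgroup_is_group[OF _ is_group, of K]
    subgroup_incl[of H K] by (simp add: order_def) (metis dvd_triv_right)

lemma psub_mono: "psub Q \<Longrightarrow> subgroup H G \<Longrightarrow> H \<subseteq> Q \<Longrightarrow> psub H"
  using subgroup_card_dvd p by (auto simp: psub_def) (metis divides_primepow_nat)

lemma psub_conj_set: "psub Q \<Longrightarrow> g \<in> carrier G \<Longrightarrow> psub (conj_set G g Q)"
  using subgroup_conj_set card_conj_set psub_carrier by (auto simp: psub_def)

lemma psub_one: "psub {\<one>}"
  using p by (auto simp: psub_def triv_subgroup intro: exI[of _ 0])

lemma maxp_psub: "maxp H S \<Longrightarrow> psub S"
  by (simp add: maxp_def)

lemma maxp_subset: "maxp H S \<Longrightarrow> S \<subseteq> H"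
  by (simp add: maxp_def)

lemma maxp_eq: "maxp H S \<Longrightarrow> psub Q \<Longrightarrow> S \<subseteq> Q \<Longrightarrow> Q \<subseteq> H \<Longrightarrow> Q = S"
  by (simp add: maxp_def)

lemma maxp_mono: "maxp H S \<Longrightarrow> S \<subseteq> K \<Longrightarrow> K \<subseteq> H \<Longrightarrow> maxp K S"
  by (auto simp: maxp_def)

lemma maxp_exists:
  assumes "psub Q" "Q \<subseteq> H"
  shows "\<exists>S. maxp H S \<and> Q \<subseteq> S"
proof -
  let ?A = "{S. psub S \<and> Q \<subseteq> S \<and> S \<subseteq> H}"
  have "finite ?A"
    by (rule finite_subset[of _ "Pow (carrier G)"]) (use fin psub_carrier in auto)
  from finite_has_maximal2[OF this, of Q] assms
  obtain S where "S \<in> ?A" "\<forall>B\<in>?A. S \<subseteq> B \<longrightarrow> S = B" by auto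
  then have "maxp H S \<and> Q \<subseteq> S" unfolding maxp_def by blast
  then show ?thesis by blast
qed

text \<open>\<open>P0\<close> has the full p-part of the order of \<open>H\<close>, so its index
  \<open>m\<close> is prime to \<open>p\<close>. Then \<open>Q\<close>, acting on the right cosets
  of \<open>P0\<close>, fixes some coset \<open>P0 x\<close>, and this means that \<open>x\<close>
  conjugates \<open>Q\<close> into \<open>P0\<close>.\<close>

lemma sylow_conj_into:
  assumes H: "subgroup H G"
  obtains P0 where "psub P0" "P0 \<subseteq> H"
    "\<And>Q. psub Q \<Longrightarrow> Q \<subseteq> H \<Longrightarrow> \<exists>h\<in>H. conj_set G h Q \<subseteq> P0"
proof -
  let ?H = "G\<lparr>carrier := H\<rparr>"
  interpret HG: group ?H by (rule subgroup.subgroup_is_group[OF H is_group])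
  have finH: "finite (carrier ?H)" using fin H subgroup.subset finite_subset by fastforce
  then have "order ?H \<noteq> 0" using HG.order_gt_0_iff_finite by blast
  then obtain m where m: "order ?H = p ^ multiplicity p (order ?H) * m" "\<not> p dvd m"
    using multiplicity_decompose'[of "order ?H" p] p by (metis not_prime_unit)
  from sylow_thm[OF p HG.is_group m(1) finH]
  obtain P0 where P0: "subgroup P0 ?H" "card P0 = p ^ multiplicity p (order ?H)" by blast
  have sub: "P0 \<subseteq> H" using subgroup.subset[OF P0(1)] by simp
  have sg: "subgroup P0 G" using incl_subgroup[OF H P0(1)] .
  have "card (rcosets\<^bsub>?H\<^esub> P0) = m"
    using HG.lagrange[OF P0(1)] m(1) P0(2) p
    by (metis mult.commute mult_cancel_left not_prime_0 power_not_zero)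
  then have nd: "\<not> p dvd card (rcosets\<^bsub>?H\<^esub> P0)" using m(2) by simp
  show ?thesis
  proof (rule that)
    show "psub P0" using sg P0(2) by (auto simp: psub_def)
    show "P0 \<subseteq> H" by fact
    fix Q assume Q: "psub Q" "Q \<subseteq> H"
    then obtain k where k: "card Q = p ^ k" by (auto simp: psub_def)
    have "subgroup Q ?H" using subgroup_incl[OF _ H Q(2)] Q(1) by (simp add: psub_def)
    from HG.card_fixed_cosets_mod_prime[OF P0(1) this p k finH] nd
    have "{R \<in> rcosets\<^bsub>?H\<^esub> P0. \<exists>x\<in>carrier ?H. R = P0 #>\<^bsub>?H\<^esub> x \<and> conj_set ?H x Q \<subseteq> P0} \<noteq> {}"
      by (metis card.empty dvd_0_right)
    then obtain x where "x \<in> H" "conj_set ?H x Q \<subseteq> P0" by auto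
    moreover have "conj_set ?H x Q = conj_set G x Q" if "x \<in> H"
      using m_inv_consistent[OF H that] by (simp add: conj_set_def)
    ultimately show "\<exists>h\<in>H. conj_set G h Q \<subseteq> P0" by auto
  qed
qed

text \<open>Some \<open>a\<close> in \<open>H\<close> carries \<open>S\<close> into
  \<open>P0\<close>. The conjugate of \<open>P0\<close> by \<open>inv a\<close> is a p-subgroup of
  \<open>H\<close> containing \<open>S\<close>, hence equal to \<open>S\<close>, so \<open>S\<close>
  inherits the absorbing property of \<open>P0\<close>.\<close>

lemma maxp_conj_into:
  assumes H: "subgroup H G" and S: "maxp H S" and Q: "psub Q" "Q \<subseteq> H"
  shows "\<exists>h\<in>H. conj_set G h Q \<subseteq> S"
proof -
  obtain P0 where P0: "psub P0" "P0 \<subseteq> H"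
    and c: "\<And>Q. psub Q \<Longrightarrow> Q \<subseteq> H \<Longrightarrow> \<exists>h\<in>H. conj_set G h Q \<subseteq> P0"
    using sylow_conj_into[OF H] by blast
  have Hc: "H \<subseteq> carrier G" using H subgroup.subset by auto
  obtain a where a: "a \<in> H" "conj_set G a S \<subseteq> P0" using c[OF maxp_psub[OF S] maxp_subset[OF S]] by blast
  have a': "a \<in> carrier G" using a Hc by auto
  have "S \<subseteq> conj_set G (inv a) P0"
    using a a' conj_set_subset_iff S P0 by (simp add: maxp_psub psub_carrier)
  moreover have "conj_set G (inv a) P0 \<subseteq> H"
    by (metis H P0(2) a(1) conj_set_mono conj_set_subgroup_id subgroup.m_inv_closed)
  moreover have "psub (conj_set G (inv a) P0)" using P0 a' by (simp add: psub_conj_set)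
  ultimately have eq: "conj_set G (inv a) P0 = S" using S by (auto simp: maxp_def)
  obtain b where b: "b \<in> H" "conj_set G b Q \<subseteq> P0" using c[OF Q] by auto
  then have "conj_set G (inv a) (conj_set G b Q) \<subseteq> S" using eq conj_set_mono by metis
  then have "conj_set G (inv a \<otimes> b) Q \<subseteq> S"
    using a' b Hc Q by (simp add: conj_set_conj_set psub_carrier subset_iff)
  then show ?thesis using a b H by (meson subgroup.m_closed subgroup.m_inv_closed)
qed

lemma maxp_conj:
  assumes H: "subgroup H G" and S: "maxp H S" and S': "maxp H S'"
  shows "\<exists>h\<in>H. conj_set G h S = S'"
proof -
  have Hc: "H \<subseteq> carrier G" using H subgroup.subset by auto
  obtain h where h: "h \<in> H" "conj_set G h S \<subseteq> S'"
    using maxp_conj_into[OF H S' maxp_psub[OF S] maxp_subset[OF S]] by blast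
  have h': "h \<in> carrier G" using h Hc by auto
  have c: "S \<subseteq> carrier G" "S' \<subseteq> carrier G" using S S' maxp_psub psub_carrier by auto
  have "S \<subseteq> conj_set G (inv h) S'" using h h' c conj_set_subset_iff by simp
  moreover have "conj_set G (inv h) S' \<subseteq> H"
    by (metis H S' h(1) conj_set_mono conj_set_subgroup_id maxp_subset subgroup.m_inv_closed)
  moreover have "psub (conj_set G (inv h) S')" using S' h' by (simp add: psub_conj_set maxp_psub)
  ultimately have "conj_set G (inv h) S' = S" using S by (auto simp: maxp_def)
  then have "conj_set G h S = S'" using h' c conj_set_inv by metis
  then show ?thesis using h by blast
qed

lemma maxp_conj_set:
  assumes g: "g \<in> carrier G" and H: "H \<subseteq> carrier G" and S: "maxp H S"
  shows "maxp (conj_set G g H) (conj_set G g S)"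
  unfolding maxp_def
proof (intro conjI allI impI)
  show "conj_set G g S \<subseteq> conj_set G g H" using S by (simp add: maxp_def conj_set_mono)
  show "psub (conj_set G g S)" using S g by (simp add: maxp_def psub_conj_set)
  fix Q assume Q: "psub Q" "conj_set G g S \<subseteq> Q" "Q \<subseteq> conj_set G g H"
  have c: "S \<subseteq> carrier G" "Q \<subseteq> carrier G" using S Q maxp_psub psub_carrier by auto
  have "S \<subseteq> conj_set G (inv g) Q" using conj_set_subset_iff g c Q by simp
  moreover have "conj_set G (inv g) Q \<subseteq> H"
    using conj_set_mono[OF Q(3), of G "inv g"] g H by (simp add: conj_set_inv)
  moreover have "psub (conj_set G (inv g) Q)" using Q g by (simp add: psub_conj_set)
  ultimately have "conj_set G (inv g) Q = S" using S by (auto simp: maxp_def)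
  then show "Q = conj_set G g S" using g c conj_set_inv by metis
qed

text \<open>A p-subgroup containing \<open>P\<close> has order \<open>p ^ k\<close> dividing the
  group order, so it is no larger than \<open>P\<close>.\<close>

lemma sylow_subgroup_maxp:
  assumes "sylow_subgroup G p P" shows "maxp (carrier G) P"
  unfolding maxp_def
proof (intro conjI allI impI)
  show P: "psub P" using assms by (auto simp: sylow_subgroup_def psub_def)
  show "P \<subseteq> carrier G" using P psub_carrier by auto
  fix Q assume Q: "psub Q" "P \<subseteq> Q"
  then obtain k where k: "card Q = p ^ k" by (auto simp: psub_def)
  have "card Q dvd order G"
    using Q psub_subgroup subgroup_card_dvd[OF _ subgroup_self] psub_carrier by (auto simp: order_def)
  then have "k \<le> multiplicity p (order G)"
    using k p fin order_gt_0_iff_finite by (metis multiplicity_geI not_prime_unit not_gr_zero)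
  then have "card Q \<le> card P"
    using assms k power_increasing[OF _ prime_ge_1_nat[OF p]] by (simp add: sylow_subgroup_def)
  then show "Q = P" using Q psub_finite card_seteq by blast
qed

section \<open>Normalizers and centres in p-groups\<close>

lemma normalizer_grows:
  assumes M: "psub M" and T: "psub T" and MT: "M \<subset> T"
  shows "\<exists>t\<in>T - M. t \<in> normz G M"
proof -
  let ?T = "G\<lparr>carrier := T\<rparr>"
  have sT: "subgroup T G" and sM: "subgroup M G" using M T psub_subgroup by auto
  interpret TG: group ?T by (rule subgroup.subgroup_is_group[OF sT is_group])
  have sMT: "subgroup M ?T" using subgroup_incl[OF sM sT] MT by auto
  obtain k l where k: "card M = p ^ k" and l: "card T = p ^ l" using M T by (auto simp: psub_def)
  have lag: "card (rcosets\<^bsub>?T\<^esub> M) * p ^ k = p ^ l"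
    using TG.lagrange[OF sMT] k l by (simp add: order_def)
  then have "card (rcosets\<^bsub>?T\<^esub> M) dvd p ^ l" by (metis dvd_triv_left)
  then obtain i where i: "card (rcosets\<^bsub>?T\<^esub> M) = p ^ i" using p divides_primepow_nat by blast
  have "i \<noteq> 0"
  proof
    assume "i = 0"
    then have "card M = card T" using lag i k l by simp
    then show False using MT psub_finite[OF T] by (metis psubset_card_mono less_irrefl)
  qed
  then have "p dvd card (rcosets\<^bsub>?T\<^esub> M)" using i by simp
  let ?F = "{R \<in> rcosets\<^bsub>?T\<^esub> M. \<exists>x\<in>carrier ?T. R = M #>\<^bsub>?T\<^esub> x \<and> conj_set ?T x M \<subseteq> M}"
  have finT: "finite (carrier ?T)" using psub_finite[OF T] by simp
  have dF: "p dvd card ?F"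
    using TG.card_fixed_cosets_mod_prime[OF sMT sMT p k finT] \<open>p dvd card (rcosets\<^bsub>?T\<^esub> M)\<close> by simp
  \<comment> \<open>\<open>M\<close> acts on its own cosets in \<open>T\<close>. Their number is a
    positive power of \<open>p\<close>, so \<open>p\<close> divides the number of fixed cosets;
    \<open>M\<close> is one of them, hence there is another, and its representative normalizes
    \<open>M\<close>.\<close>
  have "M \<in> ?F"
  proof -
    have "M #>\<^bsub>?T\<^esub> \<one> = M" using TG.coset_mult_one[of M] MT by auto
    moreover have "conj_set ?T \<one> M \<subseteq> M"
      using TG.conj_set_one[of M] MT by auto
    moreover have "\<one> \<in> T" using sT subgroup.one_closed by auto
    moreover have "M \<in> rcosets\<^bsub>?T\<^esub> M" using TG.rcosetsI[of M \<one>] \<open>M #>\<^bsub>?T\<^esub> \<one> = M\<close> \<open>\<one> \<in> T\<close> MT by auto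
    ultimately show ?thesis by force
  qed
  have "?F \<noteq> {M}" 
  proof
    assume "?F = {M}"
    then have "card ?F = 1" by simp
    then show False using dF p by (simp add: prime_nat_iff)
  qed
  then obtain R where R: "R \<in> ?F" "R \<noteq> M" using \<open>M \<in> ?F\<close> by blast
  then obtain x where x: "x \<in> T" "R = M #>\<^bsub>?T\<^esub> x" "conj_set ?T x M \<subseteq> M" by auto
  have "x \<notin> M" using TG.coset_join2[OF _ sMT] x R(2) by auto
  have xc: "x \<in> carrier G" using x sT subgroup.mem_carrier by auto
  have "conj_set G x M \<subseteq> M"
    using x m_inv_consistent[OF sT x(1)] by (simp add: conj_set_def)
  then have "conj_set G x M = M"
    using card_conj_set[OF xc psub_carrier[OF M]] psub_finite[OF M] by (simp add: card_seteq)
  then show ?thesis using \<open>x \<notin> M\<close> x xc by (auto simp: normz_def)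
qed

text \<open>This is \<open>\<Omega>\<^sub>1(Z(T))\<close> for a subgroup \<open>T\<close>, written
  without \<open>generate\<close>: the centre is abelian, so its elements killed by \<open>p\<close>
  already form a subgroup.\<close>

definition omega :: "'a set \<Rightarrow> 'a set" where
  "omega T = {x \<in> centre_of G T. x [^] p = \<one>}"

lemma psub_pow: "psub Q \<Longrightarrow> card Q = p ^ k \<Longrightarrow> x \<in> Q \<Longrightarrow> x [^] (p ^ k) = \<one>"
proof -
  assume Q: "psub Q" "card Q = p ^ k" "x \<in> Q"
  interpret QG: group "G\<lparr>carrier := Q\<rparr>"
    by (rule subgroup.subgroup_is_group[OF psub_subgroup[OF Q(1)] is_group])
  have "x [^]\<^bsub>G\<lparr>carrier := Q\<rparr>\<^esub> order (G\<lparr>carrier := Q\<rparr>) = \<one>"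
    using QG.pow_order_eq_1[of x] Q by simp
  then show ?thesis using Q by (simp add: order_def nat_pow_consistent[symmetric])
qed

text \<open>\<open>T\<close> acts on itself by conjugation and the fixed points are its centre.
  Their number is divisible by \<open>p\<close>, so there is a central \<open>z\<close> other than
  the identity, and a suitable p-power of \<open>z\<close> has order \<open>p\<close>.\<close>

lemma omega_nontrivial:
  assumes T: "psub T" "T \<noteq> {\<one>}"
  shows "omega T \<noteq> {\<one>}"
proof -
  let ?T = "G\<lparr>carrier := T\<rparr>"
  have sT: "subgroup T G" using T psub_subgroup by auto
  have Tc: "T \<subseteq> carrier G" using sT subgroup.subset by auto
  have oneT: "\<one> \<in> T" using sT subgroup.one_closed by auto
  interpret TG: group ?T by (rule subgroup.subgroup_is_group[OF sT is_group])
  obtain k where k: "card T = p ^ k" using T by (auto simp: psub_def)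
  have "k \<noteq> 0"
  proof
    assume "k = 0"
    then have "card T = 1" using k by simp
    then show False using T(2) oneT by (metis card_1_singletonE singletonD)
  qed
  let ?F = "{x \<in> T. \<forall>g\<in>carrier ?T. g \<otimes> x \<otimes> inv g = x}"
  have "p dvd card T \<longleftrightarrow> p dvd card ?F"
  proof (rule TG.card_fixed_points_mod_prime)
    show "g \<otimes> x \<otimes> inv g \<in> T" if "g \<in> carrier ?T" "x \<in> T" for g x
      using that sT by (simp add: subgroup.m_closed subgroup.m_inv_closed)
    show "\<one>\<^bsub>?T\<^esub> \<otimes> x \<otimes> inv \<one>\<^bsub>?T\<^esub> = x" if "x \<in> T" for x
      using that Tc by auto
    show "g \<otimes>\<^bsub>?T\<^esub> h \<otimes> x \<otimes> inv (g \<otimes>\<^bsub>?T\<^esub> h) = g \<otimes> (h \<otimes> x \<otimes> inv h) \<otimes> inv g"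
      if "g \<in> carrier ?T" "h \<in> carrier ?T" "x \<in> T" for g h x
      using that Tc by (simp add: m_assoc inv_mult_group subset_iff)
    show "finite T" using psub_finite T by auto
  qed (use p k in \<open>auto simp: order_def\<close>)
  then have dF: "p dvd card ?F" using k \<open>k \<noteq> 0\<close> by simp
  have "\<one> \<in> ?F" using oneT Tc by (auto simp: subset_iff)
  have "?F \<noteq> {\<one>}"
  proof
    assume "?F = {\<one>}"
    then have "card ?F = 1" by simp
    then show False using dF p by (simp add: prime_nat_iff)
  qed
  then obtain z where z: "z \<in> ?F" "z \<noteq> \<one>" using \<open>\<one> \<in> ?F\<close> by blast
  have zc: "z \<in> carrier G" using z Tc by auto
  have zcomm: "z \<otimes> g = g \<otimes> z" if "g \<in> T" for g
  proof -
    have gc: "g \<in> carrier G" using that Tc by auto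
    have "g \<otimes> z = (g \<otimes> z \<otimes> inv g) \<otimes> g" using gc zc by (simp add: m_assoc)
    also have "g \<otimes> z \<otimes> inv g = z" using z that by simp
    finally show ?thesis by simp
  qed
  have "z [^] (p ^ k) = \<one>" using psub_pow T k z by blast
  \<comment> \<open>The exponent is positive since \<open>z\<close> is not the identity; one p-th
    power earlier lies the required element \<open>w\<close>.\<close>
  define i where "i = (LEAST i. z [^] (p ^ i) = \<one>)"
  have i: "z [^] (p ^ i) = \<one>" unfolding i_def by (rule LeastI) fact
  have "i \<noteq> 0" using i z zc by (cases i) auto
  then obtain j where j: "i = Suc j" by (cases i) auto
  define w where "w = z [^] (p ^ j)"
  have "w \<noteq> \<one>" using not_less_Least[of j "\<lambda>i. z [^] (p ^ i) = \<one>"] j by (auto simp: w_def i_def)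
  moreover have "w [^] p = \<one>" using i j zc by (simp add: w_def nat_pow_pow mult.commute)
  moreover have "w \<in> T" unfolding w_def using z sT subgroup_pow_closed by blast
  moreover have "w \<otimes> g = g \<otimes> w" if "g \<in> T" for g
    unfolding w_def using group_commutes_pow[of z g] that zcomm zc Tc by auto
  ultimately have "w \<in> omega T" "w \<noteq> \<one>" by (auto simp: omega_def centre_of_def)
  then show ?thesis by auto
qed

end

context group
begin

lemma centre_of_conj_set:
  assumes g: "g \<in> carrier G" and T: "T \<subseteq> carrier G"
  shows "centre_of G (conj_set G g T) = conj_set G g (centre_of G T)"
proof -
  have "g \<otimes> x \<otimes> inv g \<otimes> (g \<otimes> y \<otimes> inv g) = g \<otimes> y \<otimes> inv g \<otimes> (g \<otimes> x \<otimes> inv g) \<longleftrightarrow> x \<otimes> y = y \<otimes> x"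
    if "x \<in> T" "y \<in> T" for x y
    using that T g by (simp add: conj_mult subset_iff)
  then show ?thesis unfolding centre_of_def conj_set_def by fastforce
qed

text \<open>Bezout gives \<open>i * u = p * v + 1\<close>, so \<open>y\<close> is the
  \<open>u\<close>-th power of \<open>y [^] i\<close>.\<close>

lemma mem_subgroup_of_pow_mem:
  assumes K: "subgroup K G" and y: "y \<in> carrier G" "y [^] p = \<one>" and p: "prime (p::nat)"
    and i: "y [^] (i::nat) \<in> K" "\<not> p dvd i"
  shows "y \<in> K"
proof -
  have "i \<noteq> 0" using i(2) by (metis dvd_0_right)
  then obtain u v where uv: "i * u = p * v + gcd i p" using bezout_nat by blast
  have "gcd i p = 1" using p i by (metis coprime_iff_gcd_eq_1 gcd.commute prime_imp_coprime)
  then have "(y [^] i) [^] u = y [^] (p * v + 1)" using uv y by (simp add: nat_pow_pow)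
  also have "\<dots> = (y [^] p) [^] v \<otimes> y" using y(1) by (simp add: nat_pow_pow)
  also have "\<dots> = y" using y by simp
  finally show ?thesis using subgroup_pow_closed[OF K i(1), of u] by simp
qed

end

section \<open>p-groups with an elementary abelian subgroup of index p\<close>

context finite_group_prime
begin

text \<open>The prime \<open>p\<close> is the product of the index of \<open>K\<close> in
  \<open>T\<close> and the index of \<open>A\<close> in \<open>K\<close>.\<close>

lemma subgroup_between_index_p:
  assumes A: "subgroup A G" and K: "subgroup K G" and T: "psub T" and sub: "A \<subseteq> K" "K \<subseteq> T"
    and card: "card T = p * card A"
  shows "K = A \<or> K = T"
proof -
  have finT: "finite T" using T psub_finite by auto
  have finK: "finite K" using finT sub finite_subset by blast
  obtain m where m: "card K = card A * m" using subgroup_card_dvd[OF A K sub(1)] by (auto simp: dvd_def)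
  obtain n where n: "card T = card K * n"
    using subgroup_card_dvd[OF K psub_subgroup[OF T] sub(2)] by (auto simp: dvd_def)
  have A0: "card A \<noteq> 0"
    using finK sub finite_subset subgroup.one_closed[OF A] by (metis card_0_eq empty_iff)
  have "card A * p = card A * (m * n)" using m n card by (simp add: mult.assoc mult.commute)
  then have "p = m * n" using A0 by simp
  then have "m = 1 \<or> n = 1" using p by (metis prime_product)
  then show ?thesis
  proof
    assume "m = 1" then show ?thesis using m sub finK by (metis card_subset_eq mult.right_neutral)
  next
    assume "n = 1" then show ?thesis using n sub finT by (metis card_subset_eq mult.right_neutral)
  qed
qed

text \<open>The map sending \<open>(a, i)\<close> with \<open>i < p\<close> to
  \<open>a \<otimes> y [^] i\<close> is injective: a collision would put a power of \<open>y\<close>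
  with exponent prime to \<open>p\<close>, and hence \<open>y\<close> itself, into \<open>A\<close>.
  Its domain has \<open>p * card A = card T\<close> elements, so it is onto
  \<open>T\<close>.\<close>

lemma index_p_decomposition:
  assumes A: "subgroup A G" and T: "psub T" and sub: "A \<subseteq> T" and card: "card T = p * card A"
    and y: "y \<in> T" "y \<notin> A" "y [^] p = \<one>" and t: "t \<in> T"
  obtains a i where "a \<in> A" "i < p" "t = a \<otimes> y [^] (i::nat)"
proof -
  have sT: "subgroup T G" and Tc: "T \<subseteq> carrier G" using T psub_subgroup psub_carrier by auto
  have yc: "y \<in> carrier G" using y Tc by auto
  let ?f = "\<lambda>(a, i). a \<otimes> y [^] (i::nat)"
  have ne: "False" if ab: "a \<in> A" "b \<in> A" and ij: "i < j" "j < p" and e: "a \<otimes> y [^] i = b \<otimes> y [^] j"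
    for a b and i j :: nat
  proof -
    have c: "a \<in> carrier G" "b \<in> carrier G" using ab sub Tc by auto
    have "y [^] j = y [^] (j - i) \<otimes> y [^] i" using ij yc by (simp add: nat_pow_mult)
    then have "a \<otimes> y [^] i = (b \<otimes> y [^] (j - i)) \<otimes> y [^] i" using e c yc by (simp add: m_assoc)
    then have "a = b \<otimes> y [^] (j - i)" using c yc by (metis m_closed nat_pow_closed right_cancel)
    then have "inv b \<otimes> a = y [^] (j - i)" using c yc by (metis inv_solve_left nat_pow_closed)
    then have "y [^] (j - i) \<in> A" using ab A by (metis subgroup.m_closed subgroup.m_inv_closed)
    moreover have "\<not> p dvd (j - i)" using ij by (auto dest: dvd_imp_le)
    ultimately show False using mem_subgroup_of_pow_mem[OF A yc y(3) p] y(2) by blast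
  qed
  have inj: "inj_on ?f (A \<times> {..<p})"
  proof (rule inj_onI)
    fix u v assume uv: "u \<in> A \<times> {..<p}" "v \<in> A \<times> {..<p}" "?f u = ?f v"
    obtain a i b j where e: "u = (a, i)" "v = (b, j)" by (metis surj_pair)
    then have h: "a \<in> A" "b \<in> A" "i < p" "j < p" "a \<otimes> y [^] i = b \<otimes> y [^] j" using uv by auto
    have c: "a \<in> carrier G" "b \<in> carrier G" using h sub Tc by auto
    have "i = j" using ne[of a b i j] ne[of b a j i] h by (metis linorder_neqE_nat)
    then show "u = v" using h c yc e by (metis nat_pow_closed right_cancel)
  qed
  have "?f ` (A \<times> {..<p}) \<subseteq> T"
    using sub y subgroup_pow_closed[OF sT] subgroup.m_closed[OF sT] by auto
  moreover have "card (?f ` (A \<times> {..<p})) = card T"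
    using card_image[OF inj] card by (simp add: card_cartesian_product mult.commute)
  ultimately have "?f ` (A \<times> {..<p}) = T"
    using psub_finite[OF T] by (metis card_subset_eq)
  then have "t \<in> ?f ` (A \<times> {..<p})" using t by simp
  then show ?thesis using that by auto
qed

text \<open>If \<open>s = a \<otimes> y [^] i\<close> commutes with \<open>y\<close>, then so does
  \<open>a\<close>. As \<open>a\<close> also commutes with the abelian \<open>A\<close>, and every
  element of \<open>T\<close> is some \<open>b \<otimes> y [^] j\<close> with \<open>b\<close> in
  \<open>A\<close>, it is central in \<open>T\<close>.\<close>

lemma index_p_centralizer_decomposition:
  assumes A: "elem_abelian G p A" and T: "psub T" and sub: "A \<subseteq> T" and card: "card T = p * card A"
    and y: "y \<in> T" "y \<notin> A" "y [^] p = \<one>" and s: "s \<in> T" "s \<otimes> y = y \<otimes> s"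
  obtains a i where "a \<in> A" "a \<in> centre_of G T" "i < p" "s = a \<otimes> y [^] (i::nat)"
proof -
  have sA: "subgroup A G" using A by (simp add: elem_abelian_def)
  have sT: "subgroup T G" and Tc: "T \<subseteq> carrier G" using T psub_subgroup psub_carrier by auto
  have yc: "y \<in> carrier G" using y Tc by auto
  obtain a i where ai: "a \<in> A" "i < p" "s = a \<otimes> y [^] (i::nat)"
    using index_p_decomposition[OF sA T sub card y s(1)] .
  have ac: "a \<in> carrier G" using ai sub Tc by auto
  have "(a \<otimes> y) \<otimes> y [^] i = a \<otimes> y [^] i \<otimes> y"
    using ac yc by (simp add: m_assoc nat_pow_Suc2[symmetric])
  also have "\<dots> = (y \<otimes> a) \<otimes> y [^] i" using s(2) ai ac yc by (simp add: m_assoc)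
  finally have ay: "a \<otimes> y = y \<otimes> a" using ac yc by (metis m_closed nat_pow_closed right_cancel)
  have "a \<otimes> t = t \<otimes> a" if t: "t \<in> T" for t
  proof -
    obtain b j where bj: "b \<in> A" "j < p" "t = b \<otimes> y [^] (j::nat)"
      using index_p_decomposition[OF sA T sub card y t] .
    have bc: "b \<in> carrier G" using bj sub Tc by auto
    have "a \<otimes> b = b \<otimes> a" using A ai bj by (auto simp: elem_abelian_def)
    moreover have "a \<otimes> y [^] j = y [^] j \<otimes> a" using group_commutes_pow[OF ay[symmetric] yc ac, of j] by simp
    ultimately show ?thesis using bj ac bc yc by (metis m_assoc nat_pow_closed)
  qed
  then have "a \<in> centre_of G T" using ai sub by (auto simp: centre_of_def)
  then show ?thesis using that ai by blast
qed

text \<open>The definition of \<open>elem_abelian\<close> bounds only the exponent. Were another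
  prime \<open>q\<close> to divide the order, there would be a nontrivial element killed by both
  \<open>p\<close> and \<open>q\<close>.\<close>

lemma elem_abelian_psub:
  assumes E: "elem_abelian G p E" shows "psub E"
proof -
  have sE: "subgroup E G" using E by (simp add: elem_abelian_def)
  let ?E = "G\<lparr>carrier := E\<rparr>"
  interpret EG: group ?E by (rule subgroup.subgroup_is_group[OF sE is_group])
  have finE: "finite E" using fin sE subgroup.subset finite_subset by blast
  have "card E \<noteq> 0" using finE subgroup.one_closed[OF sE] by auto
  then obtain m where m: "card E = p ^ multiplicity p (card E) * m" "\<not> p dvd m"
    using multiplicity_decompose'[of "card E" p] p by (metis not_prime_unit)
  have "m = 1"
  proof (rule ccontr)
    assume "m \<noteq> 1"
    then obtain q where q: "prime q" "q dvd m" using prime_factor_nat by blast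
    then have "q dvd card E" using m(1) by (metis dvd_mult)
    \<comment> \<open>The exponent 1 makes the Sylow theorem serve as Cauchy's theorem.\<close>
    then obtain n where "order ?E = q ^ 1 * n" by (auto simp: order_def dvd_def)
    from sylow_thm[OF q(1) EG.is_group this] finE
    obtain Q where Q: "subgroup Q ?E" "card Q = q" by auto
    have sQ: "subgroup Q G" using incl_subgroup[OF sE Q(1)] .
    have "Q \<noteq> {\<one>}" using Q q by auto
    then obtain x where x: "x \<in> Q" "x \<noteq> \<one>" using subgroup.one_closed[OF sQ] by auto
    have xc: "x \<in> carrier G" "x \<in> E" using x sQ Q(1) subgroup.mem_carrier subgroup.subset by fastforce+
    interpret QG: group "G\<lparr>carrier := Q\<rparr>" by (rule subgroup.subgroup_is_group[OF sQ is_group])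
    have "x [^]\<^bsub>G\<lparr>carrier := Q\<rparr>\<^esub> order (G\<lparr>carrier := Q\<rparr>) = \<one>"
      using QG.pow_order_eq_1[of x] x by simp
    then have xq: "x [^] q = \<one>" using Q by (simp add: order_def nat_pow_consistent[symmetric])
    have "\<not> p dvd q" using p q m(2) by (metis primes_dvd_imp_eq)
    moreover have "x [^] p = \<one>" using E xc by (auto simp: elem_abelian_def)
    moreover have "x [^] q \<in> {\<one>}" using xq by simp
    ultimately have "x \<in> {\<one>}"
      using mem_subgroup_of_pow_mem[OF triv_subgroup xc(1) _ p] by blast
    then show False using x by simp
  qed
  then show ?thesis using m(1) sE by (auto simp: psub_def)
qed

lemma elem_abelian_subset_centr: "elem_abelian G p E \<Longrightarrow> E \<subseteq> centr G E"
  using subgroup.mem_carrier by (fastforce simp: elem_abelian_def centr_def)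

lemma elem_abelian_carrier: "elem_abelian G p E \<Longrightarrow> E \<subseteq> carrier G"
  by (simp add: elem_abelian_def subgroup.subset)

text \<open>Some element of the centralizer conjugates \<open>E\<close> into \<open>S\<close>, and
  elements of the centralizer fix \<open>E\<close>.\<close>

lemma elem_abelian_subset_maxp_centr:
  assumes E: "elem_abelian G p E" and S: "maxp (centr G E) S"
  shows "E \<subseteq> S"
proof -
  have Ec: "E \<subseteq> carrier G" using E by (rule elem_abelian_carrier)
  obtain h where h: "h \<in> centr G E" "conj_set G h E \<subseteq> S"
    using maxp_conj_into[OF subgroup_centr[OF Ec] S elem_abelian_psub[OF E] elem_abelian_subset_centr[OF E]] by blast
  then show ?thesis using conj_set_centr_id[OF h(1) Ec] by simp
qed

lemma psub_Int: "psub T \<Longrightarrow> subgroup H G \<Longrightarrow> psub (T \<inter> H)"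
  using psub_mono subgroups_Inter_pair psub_subgroup by (metis inf_le1)

lemma conj_set_carrier: "g \<in> carrier G \<Longrightarrow> conj_set G g (carrier G) = carrier G"
  by (rule conj_set_subgroup_id[OF subgroup_self])

lemma maxp_carrier_conj_set: "maxp (carrier G) T \<Longrightarrow> g \<in> carrier G \<Longrightarrow> maxp (carrier G) (conj_set G g T)"
  using maxp_conj_set[of g "carrier G" T] conj_set_carrier by simp

text \<open>\<open>T\<close> is also a Sylow subgroup of \<open>H\<close>, so \<open>S\<close> is
  conjugate to it.\<close>

lemma maxp_subgroup_imp_maxp_carrier:
  assumes H: "subgroup H G" and T: "maxp (carrier G) T" "T \<subseteq> H" and S: "maxp H S"
  shows "maxp (carrier G) S"
proof -
  have Hc: "H \<subseteq> carrier G" using H subgroup.subset by auto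
  then have "maxp H T" using maxp_mono T by blast
  then obtain h where "h \<in> H" "conj_set G h T = S" using maxp_conj[OF H _ S] by blast
  then show ?thesis using maxp_carrier_conj_set[OF T(1)] Hc by blast
qed

lemma omega_conj_set:
  assumes g: "g \<in> carrier G" and T: "T \<subseteq> carrier G"
  shows "omega (conj_set G g T) = conj_set G g (omega T)"
proof -
  have c: "centre_of G T \<subseteq> carrier G" using T by (auto simp: centre_of_def)
  have "(g \<otimes> x \<otimes> inv g) [^] p = \<one> \<longleftrightarrow> x [^] p = \<one>" if "x \<in> carrier G" for x
    using that g conj_pow[OF g that, of p] conj_eq_iff[OF g, of "x [^] p" \<one>] by simp
  then show ?thesis using c
    unfolding omega_def centre_of_conj_set[OF g T] by (auto simp: conj_set_def subset_iff)
qed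

lemma omega_elem_abelian:
  assumes T: "subgroup T G" shows "elem_abelian G p (omega T)"
proof -
  have Tc: "T \<subseteq> carrier G" using T subgroup.subset by auto
  have om: "omega T = {x \<in> T \<inter> centr G T. x [^] p = \<one>}"
    using Tc by (auto simp: omega_def centre_of_def centr_def)
  have sZ: "subgroup (T \<inter> centr G T) G"
    by (rule subgroups_Inter_pair[OF T subgroup_centr[OF Tc]])
  have comm: "x \<otimes> y = y \<otimes> x" if "x \<in> omega T" "y \<in> omega T" for x y
    using that unfolding omega_def centre_of_def by blast
  have "subgroup (omega T) G"
  proof (rule subgroupI)
    show "omega T \<subseteq> carrier G" using om Tc by auto
    have "\<one> \<in> omega T" using om subgroup.one_closed[OF sZ] by simp
    then show "omega T \<noteq> {}" by blast
    fix a b assume ab: "a \<in> omega T" "b \<in> omega T"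
    then have c: "a \<in> carrier G" "b \<in> carrier G" using om Tc by auto
    show "inv a \<in> omega T" using ab c om subgroup.m_inv_closed[OF sZ] by (simp add: nat_pow_inv)
    from pow_mult_distrib[OF comm[OF ab] c, of p] have "(a \<otimes> b) [^] p = \<one>" using ab om by simp
    then show "a \<otimes> b \<in> omega T"
      using ab om subgroup.m_closed[OF sZ, of a b] by simp
  qed
  then show ?thesis using comm unfolding elem_abelian_def omega_def by blast
qed

end

section \<open>Centralizers and normalizers when Sylow subgroups have an elementary abelian subgroup
  of index at most p\<close>

locale index_p_sylow = finite_group_prime +
  assumes sylow_elem_abelian: "maxp (carrier G) T \<Longrightarrow>
    \<exists>A. elem_abelian G p A \<and> A \<subseteq> T \<and> (card T = card A \<or> card T = p * card A)"
begin

text \<open>Take a Sylow subgroup \<open>T\<close> containing \<open>S\<close>, so that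
  \<open>S\<close> is the centralizer of \<open>E\<close> in \<open>T\<close>, and \<open>A\<close>
  in \<open>T\<close> of index at most \<open>p\<close>. If \<open>A = T\<close>, all is elementary
  abelian. If \<open>E\<close> lies in \<open>A\<close>, then \<open>A\<close> centralizes
  \<open>E\<close>, so \<open>S\<close> lies between \<open>A\<close> and \<open>T\<close>.
  Otherwise pick \<open>y\<close> in \<open>E\<close> outside \<open>A\<close>: every element of
  \<open>S\<close> is a central element of \<open>A\<close> times a power of \<open>y\<close>, which
  makes \<open>S\<close> abelian of exponent dividing \<open>p\<close>.\<close>

lemma maxp_centr_cases:
  assumes E: "elem_abelian G p E" and S: "maxp (centr G E) S"
  shows "maxp (carrier G) S \<or> elem_abelian G p S"
proof -
  have pS: "psub S" and sS: "subgroup S G" using S maxp_psub psub_subgroup by auto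
  have Ec: "E \<subseteq> carrier G" using E by (rule elem_abelian_carrier)
  obtain T where T: "maxp (carrier G) T" "S \<subseteq> T" using maxp_exists[OF pS psub_carrier[OF pS]] by blast
  have pT: "psub T" using T maxp_psub by auto
  have TS: "T \<inter> centr G E = S"
    using maxp_eq[OF S psub_Int[OF pT subgroup_centr[OF Ec]]] T maxp_subset[OF S] by blast
  have ES: "E \<subseteq> S" by (rule elem_abelian_subset_maxp_centr[OF E S])
  obtain A where A: "elem_abelian G p A" "A \<subseteq> T" "card T = card A \<or> card T = p * card A"
    using sylow_elem_abelian[OF T(1)] by blast
  have sA: "subgroup A G" using A by (simp add: elem_abelian_def)
  show ?thesis
  proof (cases "card T = card A")
    case True
    then have "A = T" using A(2) psub_finite[OF pT] by (metis card_subset_eq)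
    then show ?thesis using elem_abelian_subset[OF A(1) _ sS] T(2) by blast
  next
    case False
    then have cT: "card T = p * card A" using A(3) by blast
    show ?thesis
    proof (cases "E \<subseteq> A")
      case True
      have "A \<subseteq> S"
        using TS A(2) elem_abelian_subset_centr[OF A(1)] centr_antimono[OF True] by blast
      then have "S = A \<or> S = T" using subgroup_between_index_p[OF sA sS pT _ T(2) cT] by blast
      then show ?thesis using A T by blast
    next
      case False
      then obtain y where y: "y \<in> E" "y \<notin> A" by blast
      have yT: "y \<in> T" and yc: "y \<in> carrier G" using y ES T(2) Ec by auto
      have yp: "y [^] p = \<one>" using E y by (simp add: elem_abelian_def)
      have dec: "\<exists>a i. a \<in> A \<and> a \<in> centre_of G T \<and> s = a \<otimes> y [^] (i::nat)" if "s \<in> S" for s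
      proof -
        have "s \<in> T" "s \<otimes> y = y \<otimes> s" using that TS y by (auto simp: centr_def)
        then show ?thesis
          using index_p_centralizer_decomposition[OF A(1) pT A(2) cT yT y(2) yp] by metis
      qed
      have "s \<otimes> t = t \<otimes> s" if st: "s \<in> S" "t \<in> S" for s t
      proof -
        obtain a i where a: "a \<in> A" "a \<in> centre_of G T" "s = a \<otimes> y [^] (i::nat)" using dec st by blast
        have tT: "t \<in> T" and tc: "t \<in> carrier G" using st T psub_carrier[OF pT] by auto
        have ac: "a \<in> carrier G" using a A(2) psub_carrier[OF pT] by auto
        have "t \<otimes> y = y \<otimes> t" using st TS y by (auto simp: centr_def)
        then have "y [^] i \<otimes> t = t \<otimes> y [^] i" using group_commutes_pow yc tc by metis
        moreover have "a \<otimes> t = t \<otimes> a" using a tT by (auto simp: centre_of_def)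
        ultimately show ?thesis using a(3) ac tc yc by (metis m_assoc nat_pow_closed)
      qed
      moreover have "s [^] p = \<one>" if s: "s \<in> S" for s
      proof -
        obtain a i where a: "a \<in> A" "a \<in> centre_of G T" "s = a \<otimes> y [^] (i::nat)" using dec s by blast
        have ac: "a \<in> carrier G" using a A(2) psub_carrier[OF pT] by auto
        have "a \<otimes> y [^] i = y [^] i \<otimes> a"
          using a(2) subgroup_pow_closed[OF psub_subgroup[OF pT] yT] by (auto simp: centre_of_def)
        then have "s [^] p = a [^] p \<otimes> (y [^] p) [^] i"
          using pow_mult_distrib[of a "y [^] i" p] a(3) ac yc by (simp add: nat_pow_pow mult.commute)
        then show ?thesis using A(1) a(1) yp by (simp add: elem_abelian_def)
      qed
      ultimately show ?thesis using sS by (auto simp: elem_abelian_def)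
    qed
  qed
qed

text \<open>\<open>M\<close> is its own centralizer in \<open>T\<close>, so it contains the centres
  of \<open>T\<close> and of its normalizer \<open>?N\<close>, and it remains to show that the
  centre of \<open>?N\<close> is central in \<open>T\<close>. If \<open>M\<close> lies in
  \<open>A\<close>, then \<open>M = A\<close> has index \<open>p\<close> and \<open>?N = T\<close>.
  Otherwise every element of \<open>M\<close> is a central element of \<open>T\<close> times a power
  of some fixed \<open>y\<close> in \<open>M\<close>, and a central element of \<open>?N\<close> not
  central in \<open>T\<close> would force \<open>?N\<close> to centralize \<open>M\<close>.\<close>

lemma centre_normalizer:
  assumes T: "maxp (carrier G) T" and M: "elem_abelian G p M" "M \<subseteq> T" "M \<noteq> T" "maxp (centr G M) M"
  shows "centre_of G (T \<inter> normz G M) = omega T" and "omega T \<subseteq> M"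
proof -
  have pT: "psub T" using T maxp_psub by auto
  have sT: "subgroup T G" and Tc: "T \<subseteq> carrier G" using psub_subgroup[OF pT] psub_carrier[OF pT] by auto
  have pM: "psub M" using M elem_abelian_psub by auto
  have Mc: "M \<subseteq> carrier G" using pM psub_carrier by auto
  have self: "t \<in> M" if "t \<in> T" "t \<in> centr G M" for t
  proof -
    have "T \<inter> centr G M = M"
      using maxp_eq[OF M(4) psub_Int[OF pT subgroup_centr[OF Mc]]] M(2) maxp_subset[OF M(4)] by blast
    then show ?thesis using that by blast
  qed
  let ?N = "T \<inter> normz G M"
  have MN: "M \<subseteq> ?N" using M(2) subgroup_subset_normz[OF psub_subgroup[OF pM]] by blast
  have Zsub: "centre_of G T \<subseteq> M"
  proof
    fix z assume "z \<in> centre_of G T"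
    then show "z \<in> M" using self[of z] M(2) Tc by (auto simp: centre_of_def centr_def subset_iff)
  qed
  then have om: "omega T = centre_of G T" using M(1) by (auto simp: omega_def elem_abelian_def)
  show "omega T \<subseteq> M" using om Zsub by simp
  have NZ: "centre_of G T \<subseteq> centre_of G ?N" using Zsub MN by (auto simp: centre_of_def)
  have ZNM: "centre_of G ?N \<subseteq> M"
  proof
    fix x assume "x \<in> centre_of G ?N"
    then show "x \<in> M" using self[of x] MN Tc by (auto simp: centre_of_def centr_def subset_iff)
  qed
  \<comment> \<open>Normalizers grow in p-groups, so \<open>?N\<close> is strictly larger than
    \<open>M\<close>; this contradicts any argument that \<open>?N\<close> centralizes
    \<open>M\<close>.\<close>
  obtain t0 where t0: "t0 \<in> ?N" "t0 \<notin> M" using normalizer_grows[OF pM pT] M(2,3) by blast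
  obtain A where A: "elem_abelian G p A" "A \<subseteq> T" "card T = card A \<or> card T = p * card A"
    using sylow_elem_abelian[OF T(1)] by blast
  have sA: "subgroup A G" using A by (simp add: elem_abelian_def)
  have "centre_of G ?N \<subseteq> centre_of G T"
  proof (cases "M \<subseteq> A")
    case True
    have "A \<subseteq> M"
      using self A(2) elem_abelian_subset_centr[OF A(1)] centr_antimono[OF True] by blast
    then have MA: "M = A" using True by blast
    have "card T = p * card A"
      using A(2,3) M(3) MA psub_finite[OF pT] by (metis card_subset_eq)
    moreover have "subgroup ?N G" by (rule subgroups_Inter_pair[OF sT subgroup_normz[OF Mc]])
    ultimately have "?N = A \<or> ?N = T"
      using subgroup_between_index_p[OF sA _ pT] MN MA by blast
    then have "?N = T" using t0 MA by blast
    then show ?thesis by simp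
  next
    case False
    then obtain y where y: "y \<in> M" "y \<notin> A" by blast
    have yT: "y \<in> T" and yc: "y \<in> carrier G" using y M(2) Mc by auto
    have yp: "y [^] p = \<one>" using M(1) y by (simp add: elem_abelian_def)
    have cT: "card T = p * card A"
      using A(2,3) y yT psub_finite[OF pT] by (metis card_subset_eq)
    have dec: "\<exists>a i. a \<in> A \<and> a \<in> centre_of G T \<and> i < p \<and> s = a \<otimes> y [^] (i::nat)" if "s \<in> M" for s
    proof -
      have "s \<in> T" "s \<otimes> y = y \<otimes> s" using that M y by (auto simp: elem_abelian_def)
      then show ?thesis
        using index_p_centralizer_decomposition[OF A(1) pT A(2) cT yT y(2) yp] by metis
    qed
    show ?thesis
    proof
      fix x assume x: "x \<in> centre_of G ?N"
      then obtain a i where a: "a \<in> A" "a \<in> centre_of G T" "i < p" "x = a \<otimes> y [^] (i::nat)"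
        using dec ZNM by blast
      have ac: "a \<in> carrier G" using a A(2) Tc by auto
      show "x \<in> centre_of G T"
      proof (cases "i = 0")
        case True
        then show ?thesis using a ac by simp
      next
        case False
        have Nc: "?N \<subseteq> carrier G" using Tc by auto
        have sC: "subgroup (centr G ?N) G" by (rule subgroup_centr[OF Nc])
        have "a \<in> centr G ?N" using a(2) ac by (auto simp: centre_of_def centr_def)
        moreover have "x \<in> centr G ?N" using x Nc by (auto simp: centre_of_def centr_def)
        moreover have "y [^] i = inv a \<otimes> x" using a ac yc by (simp add: m_assoc[symmetric])
        ultimately have "y [^] i \<in> centr G ?N"
          using sC by (simp add: subgroup.m_closed subgroup.m_inv_closed)
        moreover have "\<not> p dvd i" using a(3) False by (auto dest: dvd_imp_le)
        \<comment> \<open>Since \<open>0 < i < p\<close>, a central power \<open>y [^] i\<close>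
          makes \<open>y\<close> itself commute with \<open>?N\<close>, and then all of
          \<open>M\<close> does.\<close>
        ultimately have yN: "y \<in> centr G ?N" using mem_subgroup_of_pow_mem[OF sC yc yp p] by blast
        have "M \<subseteq> centr G ?N"
        proof
          fix m assume "m \<in> M"
          then obtain b j where b: "b \<in> A" "b \<in> centre_of G T" "m = b \<otimes> y [^] (j::nat)" using dec by blast
          have "b \<in> centr G ?N" using b A(2) Tc by (auto simp: centre_of_def centr_def)
          then show "m \<in> centr G ?N"
            using b(3) subgroup_pow_closed[OF sC yN] sC by (simp add: subgroup.m_closed)
        qed
        then have "t0 \<in> centr G M" using t0 Nc by (auto simp: centr_def subset_iff)
        then show ?thesis using self[of t0] t0 by blast
      qed
    qed
  qed
  then show "centre_of G ?N = omega T" using NZ om by blast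
qed

text \<open>The normalizer of \<open>M\<close> in \<open>T\<close> is extended to a Sylow subgroup
  \<open>Q\<close> of \<open>?R\<close>, and \<open>Q\<close> to a Sylow subgroup \<open>T2\<close>
  of the centralizer of \<open>X\<close>, which is Sylow in the whole group. Then \<open>Q\<close>
  is the normalizer of \<open>M\<close> in \<open>T2\<close>, with centre \<open>omega T2\<close>.
  This lies in \<open>M\<close>, hence is central in the normalizer of \<open>M\<close> in
  \<open>T\<close>, so \<open>omega T2 \<subseteq> omega T\<close>; equality follows because
  \<open>T\<close> and \<open>T2\<close> are conjugate.\<close>

lemma centre_maxp_normalizer:
  assumes X: "X \<subseteq> carrier G" and T: "maxp (carrier G) T" "T \<subseteq> centr G X"
    and M: "elem_abelian G p M" "M \<subseteq> T" "maxp (centr G M) M" "\<not> maxp (carrier G) M"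
  shows "\<exists>Q. maxp (centr G X \<inter> normz G M) Q \<and> centre_of G Q = omega T"
proof -
  have pT: "psub T" using T maxp_psub by auto
  have Mc: "M \<subseteq> carrier G" using M elem_abelian_carrier by auto
  have sM: "subgroup M G" using M by (simp add: elem_abelian_def)
  let ?R = "centr G X \<inter> normz G M"
  have "psub (T \<inter> normz G M)" by (rule psub_Int[OF pT subgroup_normz[OF Mc]])
  then obtain Q where Q: "maxp ?R Q" "T \<inter> normz G M \<subseteq> Q" using maxp_exists[of _ ?R] T(2) by blast
  have pQ: "psub Q" using Q maxp_psub by auto
  obtain T2 where T2: "maxp (centr G X) T2" "Q \<subseteq> T2" using maxp_exists[OF pQ, of "centr G X"] maxp_subset[OF Q(1)] by blast
  have T2c: "maxp (carrier G) T2"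
    by (rule maxp_subgroup_imp_maxp_carrier[OF subgroup_centr[OF X] T T2(1)])
  have pT2: "psub T2" using T2 maxp_psub by auto
  have QT2: "T2 \<inter> normz G M = Q"
    using maxp_eq[OF Q(1) psub_Int[OF pT2 subgroup_normz[OF Mc]]] T2 maxp_subset[OF T2(1)] maxp_subset[OF Q(1)] by blast
  have MN: "M \<subseteq> T \<inter> normz G M" using M(2) subgroup_subset_normz[OF sM] by blast
  have ZQ: "centre_of G Q = omega T2" "omega T2 \<subseteq> M"
    using centre_normalizer[OF T2c M(1) _ _ M(3)] QT2 MN Q(2) T2 M(4) T2c by blast+
  have ZT: "centre_of G (T \<inter> normz G M) = omega T"
    using centre_normalizer(1)[OF T(1) M(1,2) _ M(3)] M(4) T(1) by blast
  have "omega T2 \<subseteq> omega T"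
    using ZQ ZT MN Q(2) unfolding centre_of_def by blast
  moreover have "card (omega T2) = card (omega T)"
  proof -
    obtain g where g: "g \<in> carrier G" "conj_set G g T = T2" using maxp_conj[OF subgroup_self T(1) T2c] by blast
    have "omega T \<subseteq> carrier G" using psub_carrier[OF pT] by (auto simp: omega_def centre_of_def)
    then show ?thesis using omega_conj_set[OF g(1) psub_carrier[OF pT]] g card_conj_set by metis
  qed
  moreover have "finite (omega T)" using psub_finite[OF pT] by (simp add: omega_def centre_of_def)
  ultimately have "omega T2 = omega T" by (simp add: card_subset_eq)
  then show ?thesis using Q(1) ZQ by blast
qed

text \<open>\<open>omega T\<close> and \<open>omega T'\<close> are centres of Sylow subgroups of one
  and the same group \<open>?R\<close>, and those are conjugate in it. The conjugating element fixes
  \<open>X\<close> elementwise and preserves \<open>M\<close>, so it moves only the inserted member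
  of a chain.\<close>

lemma omega_conjugate_in_normalizer:
  assumes X: "X \<subseteq> carrier G" and T: "maxp (carrier G) T" "T \<subseteq> centr G X" "M \<subseteq> T"
    and T': "maxp (carrier G) T'" "T' \<subseteq> centr G X" "M \<subseteq> T'"
    and M: "elem_abelian G p M" "maxp (centr G M) M" "\<not> maxp (carrier G) M"
  shows "\<exists>h\<in>centr G X. conj_set G h M = M \<and> conj_set G h (omega T) = omega T'"
proof -
  have Mc: "M \<subseteq> carrier G" using M elem_abelian_carrier by auto
  let ?R = "centr G X \<inter> normz G M"
  obtain Q where Q: "maxp ?R Q" "centre_of G Q = omega T"
    using centre_maxp_normalizer[OF X T(1,2) M(1) T(3) M(2,3)] by blast
  obtain Q' where Q': "maxp ?R Q'" "centre_of G Q' = omega T'"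
    using centre_maxp_normalizer[OF X T'(1,2) M(1) T'(3) M(2,3)] by blast
  have "subgroup ?R G" by (rule subgroups_Inter_pair[OF subgroup_centr[OF X] subgroup_normz[OF Mc]])
  from maxp_conj[OF this Q(1) Q'(1)] obtain h where h: "h \<in> ?R" "conj_set G h Q = Q'" by blast
  have hc: "h \<in> carrier G" using h by (auto simp: centr_def)
  have "conj_set G h (omega T) = omega T'"
    using centre_of_conj_set[OF hc psub_carrier[OF maxp_psub[OF Q(1)]]] h(2) Q(2) Q'(2) by simp
  then show ?thesis using h by (auto simp: normz_def)
qed

end

section \<open>Chains and their orbits\<close>

lemma conj_chain_mono: "c \<subseteq> d \<Longrightarrow> conj_chain G g c \<subseteq> conj_chain G g d"
  by (auto simp: conj_chain_def)

lemma conj_chain_insert: "conj_chain G g (insert E c) = insert (conj_set G g E) (conj_chain G g c)"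
  by (simp add: conj_chain_def)

lemma Union_conj_chain: "\<Union>(conj_chain G g c) = conj_set G g (\<Union>c)"
  by (auto simp: conj_chain_def conj_set_def)

text \<open>The union of a finite nonempty chain is its largest member; the top of \<open>c\<close>
  is written \<open>\<Union>c\<close> from here on.\<close>

lemma Ap_chains_Union_mem:
  assumes "c \<in> Ap_chains G p" shows "\<Union>c \<in> c"
proof -
  have "finite c" "c \<noteq> {}" "\<forall>E\<in>c. \<forall>F\<in>c. E \<subseteq> F \<or> F \<subseteq> E" using assms by (auto simp: Ap_chains_def)
  then show ?thesis
  proof (induction rule: finite_ne_induct)
    case (singleton x)
    then show ?case by simp
  next
    case (insert x F)
    then have "\<Union>F \<in> F" by blast
    moreover from this have "x \<subseteq> \<Union>F \<or> \<Union>F \<subseteq> x" using insert.prems by blast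
    ultimately show ?case by (auto simp: subset_Un_eq Un_absorb2)
  qed
qed

lemma Ap_chains_subset: "c \<in> Ap_chains G p \<Longrightarrow> d \<subseteq> c \<Longrightarrow> d \<noteq> {} \<Longrightarrow> d \<in> Ap_chains G p"
  by (auto simp: Ap_chains_def intro: finite_subset) blast+

lemma Ap_chains_insert:
  assumes "c \<in> Ap_chains G p \<or> c = {}" "E \<in> Ap G p" "\<And>F. F \<in> c \<Longrightarrow> F \<subseteq> E \<or> E \<subseteq> F"
  shows "insert E c \<in> Ap_chains G p"
  using assms by (auto simp: Ap_chains_def)

definition chain_orbit :: "('a, 'b) monoid_scheme \<Rightarrow> 'a set set \<Rightarrow> 'a set set set" where
  "chain_orbit G c = (\<lambda>g. conj_chain G g c) ` carrier G"

context finite_group_prime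
begin

lemma Ap_carrier: "E \<in> Ap G p \<Longrightarrow> E \<subseteq> carrier G"
  using elem_abelian_carrier by (auto simp: Ap_def)

lemma Ap_chains_carrier: "c \<in> Ap_chains G p \<Longrightarrow> E \<in> c \<Longrightarrow> E \<subseteq> carrier G"
  using Ap_carrier by (auto simp: Ap_chains_def)

lemma Ap_chains_elem_abelian: "c \<in> Ap_chains G p \<Longrightarrow> E \<in> c \<Longrightarrow> elem_abelian G p E"
  by (auto simp: Ap_chains_def Ap_def)

lemma Ap_conj_set:
  assumes "g \<in> carrier G" "E \<in> Ap G p" shows "conj_set G g E \<in> Ap G p"
proof -
  have "conj_set G g E \<noteq> {\<one>}"
  proof
    assume "conj_set G g E = {\<one>}"
    then have "E = conj_set G (inv g) {\<one>}" using conj_set_inv(1)[OF assms(1) Ap_carrier[OF assms(2)]] by simp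
    then show False using assms by (auto simp: conj_set_def Ap_def)
  qed
  then show ?thesis using assms elem_abelian_conj_set by (auto simp: Ap_def)
qed

lemma Ap_chains_conj_chain:
  assumes "g \<in> carrier G" "c \<in> Ap_chains G p" shows "conj_chain G g c \<in> Ap_chains G p"
  unfolding Ap_chains_def
proof (intro CollectI conjI ballI)
  show "conj_chain G g c \<noteq> {}" "finite (conj_chain G g c)" "conj_chain G g c \<subseteq> Ap G p"
    using assms Ap_conj_set by (auto simp: Ap_chains_def conj_chain_def)
  fix E F assume "E \<in> conj_chain G g c" "F \<in> conj_chain G g c"
  then obtain E' F' where e: "E' \<in> c" "F' \<in> c" "E = conj_set G g E'" "F = conj_set G g F'"
    by (auto simp: conj_chain_def)
  then have "E' \<subseteq> F' \<or> F' \<subseteq> E'" using assms by (auto simp: Ap_chains_def)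
  then show "E \<subseteq> F \<or> F \<subseteq> E" using e conj_set_mono by metis
qed

lemma conj_chain_conj_chain:
  assumes "g \<in> carrier G" "h \<in> carrier G" "c \<in> Ap_chains G p"
  shows "conj_chain G g (conj_chain G h c) = conj_chain G (g \<otimes> h) c"
  using assms conj_set_conj_set[OF assms(1,2)] Ap_chains_carrier[OF assms(3)]
  by (auto simp: conj_chain_def image_image)

lemma conj_chain_one: "c \<in> Ap_chains G p \<Longrightarrow> conj_chain G \<one> c = c"
  using conj_set_one Ap_chains_carrier by (force simp: conj_chain_def)

lemma conj_chain_centr_id:
  assumes "h \<in> centr G (\<Union>c)" "\<Union>c \<subseteq> carrier G" shows "conj_chain G h c = c"
proof -
  have "conj_set G h E = E" if "E \<in> c" for E
  proof (rule conj_set_centr_id)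
    show "h \<in> centr G E" using assms(1) centr_antimono[of E "\<Union>c"] that by blast
    show "E \<subseteq> carrier G" using assms(2) that by blast
  qed
  then show ?thesis by (simp add: conj_chain_def)
qed

text \<open>Conjugating both representatives by a common element brings the larger one back to
  \<open>d\<close>.\<close>

lemma orbit_le_chain_orbit_iff:
  assumes "c \<in> Ap_chains G p" "d \<in> Ap_chains G p"
  shows "orbit_le (chain_orbit G c) (chain_orbit G d) \<longleftrightarrow> (\<exists>g\<in>carrier G. conj_chain G g c \<subseteq> d)"
proof
  assume "orbit_le (chain_orbit G c) (chain_orbit G d)"
  then obtain g h where gh: "g \<in> carrier G" "h \<in> carrier G" "conj_chain G g c \<subseteq> conj_chain G h d"
    by (auto simp: orbit_le_def chain_orbit_def)
  have "conj_chain G (inv h) (conj_chain G g c) \<subseteq> conj_chain G (inv h) (conj_chain G h d)"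
    using gh(3) by (rule conj_chain_mono)
  then have "conj_chain G (inv h \<otimes> g) c \<subseteq> d"
    using gh assms by (simp add: conj_chain_conj_chain conj_chain_one)
  then show "\<exists>g\<in>carrier G. conj_chain G g c \<subseteq> d" using gh by (meson inv_closed m_closed)
next
  assume "\<exists>g\<in>carrier G. conj_chain G g c \<subseteq> d"
  then obtain g where "g \<in> carrier G" "conj_chain G g c \<subseteq> d" by blast
  moreover have "d \<in> chain_orbit G d"
    unfolding chain_orbit_def using conj_chain_one[OF assms(2)] by (metis imageI one_closed)
  ultimately show "orbit_le (chain_orbit G c) (chain_orbit G d)"
    by (auto simp: orbit_le_def chain_orbit_def)
qed

section \<open>Full members and Sylow pairs\<close>

definition full :: "'a set \<Rightarrow> bool" where
  "full E \<longleftrightarrow> (\<exists>T. maxp (carrier G) T \<and> T \<subseteq> centr G E)"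

text \<open>By \<open>full_antimono\<close> this is a lower segment of the chain. An elementary
  abelian \<open>E\<close> is full exactly when it lies in \<open>omega T\<close> for some Sylow
  subgroup \<open>T\<close>.\<close>

definition full_part :: "'a set set \<Rightarrow> 'a set set" where
  "full_part c = {E \<in> c. full E}"

text \<open>The Sylow subgroups \<open>S\<close> of the centralizer of \<open>c\<close> are unique only up to conjugation by elements which
  fix every member of \<open>c\<close>. Hence the orbits of the three chains below depend only on the orbit of \<open>c\<close>.\<close>

definition sylow_pair :: "'a set set \<Rightarrow> 'a set \<Rightarrow> 'a set \<Rightarrow> bool" where
  "sylow_pair c S T \<longleftrightarrow> maxp (centr G (\<Union>c)) S \<and> maxp (carrier G) T \<and>
     T \<subseteq> centr G (\<Union>(full_part c)) \<and> S \<subseteq> T"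

definition add_sylow :: "'a set set \<Rightarrow> 'a set \<Rightarrow> 'a set \<Rightarrow> 'a set set" where
  "add_sylow c S T = (if full (\<Union>c) then c else insert S c)"

definition keep_full :: "'a set set \<Rightarrow> 'a set \<Rightarrow> 'a set \<Rightarrow> 'a set set" where
  "keep_full c S T = (if full (\<Union>c) then c else insert S (full_part c))"

definition add_omega :: "'a set set \<Rightarrow> 'a set \<Rightarrow> 'a set \<Rightarrow> 'a set set" where
  "add_omega c S T = insert (omega T) (keep_full c S T)"

lemma full_antimono: "full F \<Longrightarrow> E \<subseteq> F \<Longrightarrow> full E"
  using centr_antimono unfolding full_def by blast

lemma full_part_eq: "full (\<Union>c) \<Longrightarrow> full_part c = c"
  using full_antimono unfolding full_part_def by blast

lemma full_part_mono: "c \<subseteq> d \<Longrightarrow> full_part c \<subseteq> full_part d"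
  by (auto simp: full_part_def)

lemma full_part_subset: "full_part c \<subseteq> c"
  by (auto simp: full_part_def)

lemma full_conj_set:
  assumes "g \<in> carrier G" "E \<subseteq> carrier G" shows "full (conj_set G g E) \<longleftrightarrow> full E"
proof -
  have *: "full (conj_set G g E)" if g: "g \<in> carrier G" and E: "E \<subseteq> carrier G" "full E" for g E
  proof -
    obtain T where T: "maxp (carrier G) T" "T \<subseteq> centr G E" using E by (auto simp: full_def)
    have "conj_set G g T \<subseteq> centr G (conj_set G g E)"
      using centr_conj_set[OF g E(1)] conj_set_mono[OF T(2)] by simp
    then show ?thesis using maxp_carrier_conj_set[OF T(1) g] by (auto simp: full_def)
  qed
  show ?thesis
    using *[OF assms] *[OF inv_closed[OF assms(1)] conj_set_closed[OF assms]] conj_set_inv(1)[OF assms] by auto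
qed

lemma full_part_conj_chain:
  assumes "g \<in> carrier G" "c \<in> Ap_chains G p"
  shows "full_part (conj_chain G g c) = conj_chain G g (full_part c)"
  using full_conj_set[OF assms(1)] Ap_chains_carrier[OF assms(2)]
  by (auto simp: full_part_def conj_chain_def)

lemma Union_full_part_carrier: "c \<in> Ap_chains G p \<Longrightarrow> \<Union>(full_part c) \<subseteq> carrier G"
  using Ap_chains_carrier full_part_subset by blast

lemma Union_carrier: "c \<in> Ap_chains G p \<Longrightarrow> \<Union>c \<subseteq> carrier G"
  using Ap_chains_carrier by blast

lemma full_part_chain: "c \<in> Ap_chains G p \<Longrightarrow> full_part c \<in> Ap_chains G p \<or> full_part c = {}"
  using Ap_chains_subset full_part_subset by blast

lemma sylow_pair_conj:
  assumes g: "g \<in> carrier G" and c: "c \<in> Ap_chains G p" and st: "sylow_pair c S T"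
  shows "sylow_pair (conj_chain G g c) (conj_set G g S) (conj_set G g T)"
  unfolding sylow_pair_def
proof (intro conjI)
  show "maxp (centr G (\<Union>(conj_chain G g c))) (conj_set G g S)"
    using maxp_conj_set[OF g centr_subset_carrier] st
    by (simp add: Union_conj_chain centr_conj_set[OF g Union_carrier[OF c]] sylow_pair_def)
  show "maxp (carrier G) (conj_set G g T)" using maxp_carrier_conj_set g st by (simp add: sylow_pair_def)
  show "conj_set G g T \<subseteq> centr G (\<Union>(full_part (conj_chain G g c)))"
    using st by (simp add: full_part_conj_chain[OF g c] Union_conj_chain
        centr_conj_set[OF g Union_full_part_carrier[OF c]] conj_set_mono sylow_pair_def)
  show "conj_set G g S \<subseteq> conj_set G g T" using st by (simp add: conj_set_mono sylow_pair_def)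
qed

lemma
  assumes g: "g \<in> carrier G" and c: "c \<in> Ap_chains G p"
  shows add_sylow_conj: "add_sylow (conj_chain G g c) (conj_set G g S) (conj_set G g T) = conj_chain G g (add_sylow c S T)"
    and keep_full_conj: "keep_full (conj_chain G g c) (conj_set G g S) (conj_set G g T) = conj_chain G g (keep_full c S T)"
  using full_conj_set[OF g Union_carrier[OF c]]
  by (simp_all add: add_sylow_def keep_full_def Union_conj_chain full_part_conj_chain[OF g c] conj_chain_insert)

lemma add_omega_conj:
  assumes g: "g \<in> carrier G" and c: "c \<in> Ap_chains G p" and T: "T \<subseteq> carrier G"
  shows "add_omega (conj_chain G g c) (conj_set G g S) (conj_set G g T) = conj_chain G g (add_omega c S T)"
  by (simp add: add_omega_def keep_full_conj[OF g c] conj_chain_insert omega_conj_set[OF g T])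

text \<open>\<open>T\<close> is chosen maximal in the centralizer of the full part. The top of the
  full part is itself full, so this centralizer contains a Sylow subgroup of the whole group and
  \<open>T\<close> is one too; if the full part is empty, the centralizer is everything.\<close>

lemma sylow_pair_exists:
  assumes c: "c \<in> Ap_chains G p"
  shows "\<exists>S T. sylow_pair c S T"
proof -
  have "{\<one>} \<subseteq> centr G (\<Union>c)" using subgroup.one_closed[OF subgroup_centr[OF Union_carrier[OF c]]] by simp
  then obtain S where S: "maxp (centr G (\<Union>c)) S" using maxp_exists[OF psub_one] by blast
  have sub: "centr G (\<Union>c) \<subseteq> centr G (\<Union>(full_part c))"
    by (rule centr_antimono) (use full_part_subset in blast)
  obtain T where T: "maxp (centr G (\<Union>(full_part c))) T" "S \<subseteq> T"
    using maxp_exists[OF maxp_psub[OF S]] maxp_subset[OF S] sub by blast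
  have "maxp (carrier G) T"
  proof (cases "full_part c = {}")
    case True
    then have "centr G (\<Union>(full_part c)) = carrier G" by (auto simp: centr_def)
    then show ?thesis using T by simp
  next
    case False
    then have "\<Union>(full_part c) \<in> full_part c" using full_part_chain[OF c] Ap_chains_Union_mem by blast
    then obtain T0 where "maxp (carrier G) T0" "T0 \<subseteq> centr G (\<Union>(full_part c))"
      by (auto simp: full_part_def full_def)
    then show ?thesis
      using maxp_subgroup_imp_maxp_carrier[OF subgroup_centr[OF Union_full_part_carrier[OF c]] _ _ T(1)] by blast
  qed
  then have "sylow_pair c S T" using S T(2) maxp_subset[OF T(1)] by (simp add: sylow_pair_def)
  then show ?thesis by blast
qed

end

section \<open>The three constructions on chains and their monotonicity\<close>

context index_p_sylow
begin

text \<open>\<open>S\<close> centralizes the top of \<open>c\<close>, so it cannot be Sylow in the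
  whole group and \<open>maxp_centr_cases\<close> makes it elementary abelian. It then contains the
  top, and by \<open>maxp_mono\<close> it is a Sylow subgroup of its own centralizer, so
  \<open>centre_normalizer\<close> applies to \<open>S\<close> inside \<open>T\<close>.\<close>

lemma sylow_pair_not_full:
  assumes c: "c \<in> Ap_chains G p" and st: "sylow_pair c S T" and nf: "\<not> full (\<Union>c)"
  shows "elem_abelian G p S" "\<not> maxp (carrier G) S" "\<Union>c \<subseteq> S" "maxp (centr G S) S" "omega T \<subseteq> S" "S \<in> Ap G p"
proof -
  have U: "\<Union>c \<in> c" using Ap_chains_Union_mem[OF c] .
  have eU: "elem_abelian G p (\<Union>c)" using Ap_chains_elem_abelian[OF c U] .
  have S: "maxp (centr G (\<Union>c)) S" using st by (simp add: sylow_pair_def)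
  show nS: "\<not> maxp (carrier G) S" using nf maxp_subset[OF S] by (auto simp: full_def)
  show eS: "elem_abelian G p S" using maxp_centr_cases[OF eU S] nS by blast
  show US: "\<Union>c \<subseteq> S" by (rule elem_abelian_subset_maxp_centr[OF eU S])
  show mS: "maxp (centr G S) S"
    by (rule maxp_mono[OF S elem_abelian_subset_centr[OF eS] centr_antimono[OF US]])
  have "maxp (carrier G) T" "S \<subseteq> T" using st by (auto simp: sylow_pair_def)
  then show "omega T \<subseteq> S" using centre_normalizer(2)[OF _ eS _ _ mS] nS by blast
  have "\<Union>c \<in> Ap G p" using U c by (auto simp: Ap_chains_def)
  then have "S \<noteq> {\<one>}" using US subgroup.one_closed[of "\<Union>c" G] by (auto simp: Ap_def elem_abelian_def)
  then show "S \<in> Ap G p" using eS by (simp add: Ap_def)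
qed

text \<open>\<open>T\<close> is a Sylow subgroup of the centralizer of the top \<open>?U\<close> of
  the full part, so it contains \<open>?U\<close>; thus \<open>?U\<close> is central in
  \<open>T\<close> and of exponent dividing \<open>p\<close>.\<close>

lemma full_part_subset_omega:
  assumes c: "c \<in> Ap_chains G p" and st: "sylow_pair c S T"
  shows "\<Union>(full_part c) \<subseteq> omega T"
proof (cases "full_part c = {}")
  case False
  let ?U = "\<Union>(full_part c)"
  have "?U \<in> full_part c" using False full_part_chain[OF c] Ap_chains_Union_mem by blast
  then have eU: "elem_abelian G p ?U" using Ap_chains_elem_abelian[OF c] full_part_subset by blast
  have T: "maxp (carrier G) T" "T \<subseteq> centr G ?U" using st by (auto simp: sylow_pair_def)
  have "maxp (centr G ?U) T" by (rule maxp_mono[OF T centr_subset_carrier])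
  then have "?U \<subseteq> T" by (rule elem_abelian_subset_maxp_centr[OF eU])
  show ?thesis
  proof
    fix x assume x: "x \<in> ?U"
    have "x [^] p = \<one>" using eU x unfolding elem_abelian_def by blast
    moreover have "x \<otimes> t = t \<otimes> x" if "t \<in> T" for t
    proof -
      have "t \<in> centr G ?U" using T(2) that by (rule subsetD)
      then show ?thesis using x unfolding centr_def by (metis (mono_tags, lifting) mem_Collect_eq)
    qed
    moreover have "x \<in> T" using \<open>?U \<subseteq> T\<close> x by (rule subsetD)
    ultimately show "x \<in> omega T" by (simp add: omega_def centre_of_def)
  qed
qed simp

lemma add_sylow_chain:
  assumes c: "c \<in> Ap_chains G p" and st: "sylow_pair c S T"
  shows "add_sylow c S T \<in> Ap_chains G p"
proof (cases "full (\<Union>c)")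
  case False
  have "insert S c \<in> Ap_chains G p"
    by (rule Ap_chains_insert) (use c sylow_pair_not_full(3,6)[OF c st False] in blast)+
  then show ?thesis using False by (simp add: add_sylow_def)
qed (use c in \<open>simp add: add_sylow_def\<close>)

lemma keep_full_chain:
  assumes c: "c \<in> Ap_chains G p" and st: "sylow_pair c S T"
  shows "keep_full c S T \<in> Ap_chains G p"
proof (cases "full (\<Union>c)")
  case False
  have "insert S (full_part c) \<in> Ap_chains G p"
    by (rule Ap_chains_insert)
      (use full_part_chain[OF c] full_part_subset[of c] sylow_pair_not_full(3,6)[OF c st False] in blast)+
  then show ?thesis using False by (simp add: keep_full_def)
qed (use c in \<open>simp add: keep_full_def\<close>)

text \<open>As \<open>p\<close> divides the group order there is a subgroup of order
  \<open>p\<close>, so the maximal p-subgroup \<open>T\<close> cannot be trivial.\<close>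

lemma omega_Ap:
  assumes "p dvd order G" "maxp (carrier G) T" shows "omega T \<in> Ap G p"
proof -
  have pT: "psub T" using assms maxp_psub by auto
  have "T \<noteq> {\<one>}"
  proof
    assume T1: "T = {\<one>}"
    obtain m where "order G = p ^ 1 * m" using assms(1) by (auto simp: dvd_def)
    from sylow_thm[OF p is_group this fin] obtain H where H: "subgroup H G" "card H = p" by auto
    then have "psub H" by (auto simp: psub_def intro: exI[of _ 1])
    then have "H = T" using maxp_eq[OF assms(2)] T1 subgroup.one_closed[OF H(1)] psub_carrier by blast
    then show False using T1 H(2) p by auto
  qed
  then show ?thesis using omega_nontrivial[OF pT] omega_elem_abelian[OF psub_subgroup[OF pT]] by (auto simp: Ap_def)
qed

lemma add_omega_chain:
  assumes c: "c \<in> Ap_chains G p" and st: "sylow_pair c S T" and d: "p dvd order G"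
  shows "add_omega c S T \<in> Ap_chains G p"
  unfolding add_omega_def
proof (rule Ap_chains_insert)
  show "keep_full c S T \<in> Ap_chains G p \<or> keep_full c S T = {}" using keep_full_chain[OF c st] by blast
  show "omega T \<in> Ap G p" using omega_Ap d st by (simp add: sylow_pair_def)
  fix F assume F: "F \<in> keep_full c S T"
  show "F \<subseteq> omega T \<or> omega T \<subseteq> F"
  proof (cases "full (\<Union>c)")
    case True
    then show ?thesis using F full_part_subset_omega[OF c st] full_part_eq by (auto simp: keep_full_def)
  next
    case False
    then show ?thesis using F full_part_subset_omega[OF c st] sylow_pair_not_full(5)[OF c st] by (auto simp: keep_full_def)
  qed
qed

text \<open>A larger chain still yields the same \<open>S\<close> up to conjugacy. A Sylow subgroup
  \<open>R\<close> of the centralizer of \<open>\<Union>c\<close> containing \<open>S'\<close> is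
  conjugate to \<open>S\<close>, hence abelian; it contains \<open>\<Union>d\<close>, so it
  centralizes \<open>\<Union>d\<close>, and maximality of \<open>S'\<close> gives
  \<open>R = S'\<close>.\<close>

lemma sylow_pair_conj_centr:
  assumes c: "c \<in> Ap_chains G p" and d: "d \<in> Ap_chains G p" and cd: "c \<subseteq> d"
    and st: "sylow_pair c S T" and st': "sylow_pair d S' T'" and nf: "\<not> full (\<Union>c)"
  shows "\<exists>h\<in>centr G (\<Union>c). conj_set G h S = S'"
proof -
  have Ucd: "\<Union>c \<subseteq> \<Union>d" using cd by blast
  have nf': "\<not> full (\<Union>d)" using nf full_antimono[OF _ Ucd] by blast
  have S: "maxp (centr G (\<Union>c)) S" and S': "maxp (centr G (\<Union>d)) S'"
    using st st' by (auto simp: sylow_pair_def)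
  have sC: "subgroup (centr G (\<Union>c)) G" by (rule subgroup_centr[OF Union_carrier[OF c]])
  have S'c: "S' \<subseteq> centr G (\<Union>c)" using maxp_subset[OF S'] centr_antimono[OF Ucd] by blast
  obtain R where R: "maxp (centr G (\<Union>c)) R" "S' \<subseteq> R" using maxp_exists[OF maxp_psub[OF S'] S'c] by blast
  obtain h where h: "h \<in> centr G (\<Union>c)" "conj_set G h S = R" using maxp_conj[OF sC S R(1)] by blast
  have hc: "h \<in> carrier G" using h(1) by (simp add: centr_def)
  have eR: "elem_abelian G p R"
    using elem_abelian_conj_set[OF hc sylow_pair_not_full(1)[OF c st nf]] h(2) by simp
  have "\<Union>d \<subseteq> R" using sylow_pair_not_full(3)[OF d st' nf'] R(2) by blast
  then have "R \<subseteq> centr G (\<Union>d)" using elem_abelian_subset_centr[OF eR] centr_antimono by blast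
  then have "R = S'" using maxp_eq[OF S' maxp_psub[OF R(1)] R(2)] by blast
  then show ?thesis using h by blast
qed

text \<open>The case \<open>c = d\<close> shows that the orbits do not depend on the choice of
  \<open>S\<close> and \<open>T\<close>; the general case gives monotonicity. The conjugating
  elements are found in centralizers of \<open>c\<close> or of its full part, so they fix the
  members that must stay.\<close>

lemma
  assumes c: "c \<in> Ap_chains G p" and d: "d \<in> Ap_chains G p" and cd: "c \<subseteq> d"
    and st: "sylow_pair c S T" and st': "sylow_pair d S' T'"
  shows add_sylow_mono: "\<exists>h\<in>carrier G. conj_chain G h (add_sylow c S T) \<subseteq> add_sylow d S' T'"
    and keep_full_mono: "\<exists>h\<in>carrier G. conj_chain G h (keep_full c S T) \<subseteq> keep_full d S' T'"
    and add_omega_mono: "\<exists>h\<in>carrier G. conj_chain G h (add_omega c S T) \<subseteq> add_omega d S' T'"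
proof -
  have Ucd: "\<Union>c \<subseteq> \<Union>d" using cd by blast
  have T: "maxp (carrier G) T" "T \<subseteq> centr G (\<Union>(full_part c))" "S \<subseteq> T"
    and T': "maxp (carrier G) T'" "T' \<subseteq> centr G (\<Union>(full_part d))" "S' \<subseteq> T'"
    using st st' by (auto simp: sylow_pair_def)
  have Tc: "T \<subseteq> carrier G" using T maxp_subset by blast
  have fcd: "full_part c \<subseteq> full_part d" using full_part_mono[OF cd] .
  have T'c: "T' \<subseteq> centr G (\<Union>(full_part c))"
    using T'(2) centr_antimono[of "\<Union>(full_part c)" "\<Union>(full_part d)"] fcd by blast
  have "(\<exists>h\<in>carrier G. conj_chain G h (add_sylow c S T) \<subseteq> add_sylow d S' T') \<and>
    (\<exists>h\<in>carrier G. conj_chain G h (keep_full c S T) \<subseteq> keep_full d S' T') \<and>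
    (\<exists>h\<in>carrier G. conj_chain G h (add_omega c S T) \<subseteq> add_omega d S' T')"
  proof (cases "full (\<Union>c)")
    case True
    have fc: "full_part c = c" by (rule full_part_eq[OF True])
    have eq1: "add_sylow c S T = c" and eq2: "keep_full c S T = c" using True by (auto simp: add_sylow_def keep_full_def)
    have c1: "c \<subseteq> add_sylow d S' T'" using cd by (auto simp: add_sylow_def)
    \<comment> \<open>All members of \<open>c\<close> are full, so none of them is discarded from
      \<open>d\<close>, even when the top of \<open>d\<close> is not full.\<close>
    have c2: "c \<subseteq> keep_full d S' T'" using cd fc fcd by (auto simp: keep_full_def)
    have U: "\<Union>c \<subseteq> carrier G" using Union_carrier[OF c] .
    have "maxp (centr G (\<Union>c)) T" "maxp (centr G (\<Union>c)) T'"
      using maxp_mono[OF T(1) _ centr_subset_carrier] maxp_mono[OF T'(1) _ centr_subset_carrier] T(2) T'c fc by auto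
    then obtain h where h: "h \<in> centr G (\<Union>c)" "conj_set G h T = T'"
      using maxp_conj[OF subgroup_centr[OF U]] by blast
    have hc: "h \<in> carrier G" using h(1) by (simp add: centr_def)
    have "conj_chain G h (add_omega c S T) = insert (omega T') c"
      using conj_chain_centr_id[OF h(1) U] omega_conj_set[OF hc Tc] h(2) by (simp add: add_omega_def eq2 conj_chain_insert)
    then have "conj_chain G h (add_omega c S T) \<subseteq> add_omega d S' T'" using c2 by (auto simp: add_omega_def)
    moreover have "conj_chain G \<one> c = c" by (rule conj_chain_one[OF c])
    ultimately show ?thesis using hc eq1 eq2 c1 c2 by (metis one_closed)
  next
    case False
    have nd: "\<not> full (\<Union>d)" using False full_antimono[OF _ Ucd] by blast
    have eq1: "add_sylow c S T = insert S c" "add_sylow d S' T' = insert S' d"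
      and eq2: "keep_full c S T = insert S (full_part c)" "keep_full d S' T' = insert S' (full_part d)"
      using False nd by (auto simp: add_sylow_def keep_full_def)
    obtain h where h: "h \<in> centr G (\<Union>c)" "conj_set G h S = S'"
      using sylow_pair_conj_centr[OF c d cd st st' False] by blast
    have hc: "h \<in> carrier G" using h(1) by (simp add: centr_def)
    let ?X = "\<Union>(full_part c)"
    have X: "?X \<subseteq> carrier G" by (rule Union_full_part_carrier[OF c])
    have hX: "h \<in> centr G ?X" using h(1) centr_antimono[of ?X "\<Union>c"] full_part_subset[of c] by blast
    have hid: "conj_chain G h c = c" "conj_chain G h (full_part c) = full_part c"
      using conj_chain_centr_id[OF h(1) Union_carrier[OF c]] conj_chain_centr_id[OF hX X] by auto
    have "conj_chain G h (add_sylow c S T) \<subseteq> add_sylow d S' T'" "conj_chain G h (keep_full c S T) \<subseteq> keep_full d S' T'"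
      using eq1 eq2 hid h(2) cd fcd by (auto simp: conj_chain_insert)
    moreover
    let ?T = "conj_set G h T"
    have T1: "maxp (carrier G) ?T" by (rule maxp_carrier_conj_set[OF T(1) hc])
    have T2: "?T \<subseteq> centr G ?X"
      using conj_set_mono[OF T(2)] conj_set_subgroup_id[OF subgroup_centr[OF X] hX] by metis
    have T3: "S' \<subseteq> ?T" using conj_set_mono[OF T(3)] h(2) by metis
    note S' = sylow_pair_not_full[OF d st' nd]
    \<comment> \<open>After \<open>h\<close> has matched \<open>S\<close> with \<open>S'\<close>,
      both \<open>?T\<close> and \<open>T'\<close> contain \<open>S'\<close> but may differ. The
      correction \<open>k\<close> matches \<open>omega ?T\<close> with \<open>omega T'\<close> while
      keeping \<open>S'\<close> and the full part of \<open>c\<close>.\<close>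
    obtain k where k: "k \<in> centr G ?X" "conj_set G k S' = S'" "conj_set G k (omega ?T) = omega T'"
      using omega_conjugate_in_normalizer[OF X T1 T2 T3 T'(1) T'c T'(3) S'(1,4,2)] by blast
    have kc: "k \<in> carrier G" using k(1) by (simp add: centr_def)
    have omc: "omega T \<subseteq> carrier G" using Tc by (auto simp: omega_def centre_of_def)
    have "S \<subseteq> carrier G" using T(3) Tc by blast
    have "conj_chain G (k \<otimes> h) (add_omega c S T) = insert (omega T') (insert S' (full_part c))"
    proof -
      have "conj_set G (k \<otimes> h) (omega T) = omega T'"
        using conj_set_conj_set[OF kc hc omc] omega_conj_set[OF hc Tc] k(3) by simp
      moreover have "conj_set G (k \<otimes> h) S = S'"
        using conj_set_conj_set[OF kc hc \<open>S \<subseteq> carrier G\<close>] h(2) k(2) by simp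
      moreover have "conj_chain G (k \<otimes> h) (full_part c) = full_part c"
        using conj_chain_centr_id[OF _ X] subgroup.m_closed[OF subgroup_centr[OF X] k(1) hX] by blast
      ultimately show ?thesis by (simp add: add_omega_def eq2 conj_chain_insert)
    qed
    then have "conj_chain G (k \<otimes> h) (add_omega c S T) \<subseteq> add_omega d S' T'" using fcd by (auto simp: add_omega_def eq2)
    ultimately show ?thesis using hc kc by (meson m_closed)
  qed
  then show "\<exists>h\<in>carrier G. conj_chain G h (add_sylow c S T) \<subseteq> add_sylow d S' T'"
    "\<exists>h\<in>carrier G. conj_chain G h (keep_full c S T) \<subseteq> keep_full d S' T'"
    "\<exists>h\<in>carrier G. conj_chain G h (add_omega c S T) \<subseteq> add_omega d S' T'" by blast+
qed

section \<open>Contractibility of the orbit space\<close>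

lemma orbit_space_contractible:
  assumes dvd: "p dvd order G"
  shows "contractible_space (orbit_space G p)"
proof -
  let ?X = "chain_orbits G p"
  have os: "orbit_space G p = downset_space ?X orbit_le"
    by (simp add: orbit_space_def downset_space_def)
  obtain ch sS sT where ch: "\<And>w. w \<in> ?X \<Longrightarrow> ch w \<in> Ap_chains G p \<and> w = chain_orbit G (ch w) \<and> sylow_pair (ch w) (sS w) (sT w)"
  proof -
    have "\<forall>w\<in>?X. \<exists>c S T. c \<in> Ap_chains G p \<and> w = chain_orbit G c \<and> sylow_pair c S T"
      using sylow_pair_exists by (fastforce simp: chain_orbits_def chain_orbit_def)
    then have "\<exists>ch sS sT. \<forall>w\<in>?X. ch w \<in> Ap_chains G p \<and> w = chain_orbit G (ch w) \<and> sylow_pair (ch w) (sS w) (sT w)"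
      by metis
    then show ?thesis by (elim exE) (rule that, blast)
  qed
  have orb: "chain_orbit G c \<in> ?X" if "c \<in> Ap_chains G p" for c
    using that by (auto simp: chain_orbits_def chain_orbit_def)
  \<comment> \<open>The self-map of the orbit poset induced by a construction \<open>F\<close>,
    evaluated at a chosen representative and a chosen Sylow pair of it.\<close>
  let ?f = "\<lambda>F w. chain_orbit G (F (ch w) (sS w) (sT w))"
  have mono: "mono_map ?X orbit_le (?f F)"
    if chain: "\<And>c S T. c \<in> Ap_chains G p \<Longrightarrow> sylow_pair c S T \<Longrightarrow> F c S T \<in> Ap_chains G p"
      and eqv: "\<And>g c S T. g \<in> carrier G \<Longrightarrow> c \<in> Ap_chains G p \<Longrightarrow> sylow_pair c S T \<Longrightarrow>
         F (conj_chain G g c) (conj_set G g S) (conj_set G g T) = conj_chain G g (F c S T)"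
      and mon: "\<And>c d S T S' T'. c \<in> Ap_chains G p \<Longrightarrow> d \<in> Ap_chains G p \<Longrightarrow> c \<subseteq> d \<Longrightarrow>
         sylow_pair c S T \<Longrightarrow> sylow_pair d S' T' \<Longrightarrow> \<exists>h\<in>carrier G. conj_chain G h (F c S T) \<subseteq> F d S' T'"
    for F
    unfolding mono_map_def
  proof (intro conjI ballI impI)
    show "?f F \<in> ?X \<rightarrow> ?X" using ch chain orb by blast
    fix v w assume v: "v \<in> ?X" and w: "w \<in> ?X" and le: "orbit_le v w"
    have cv: "ch v \<in> Ap_chains G p" "sylow_pair (ch v) (sS v) (sT v)"
      and cw: "ch w \<in> Ap_chains G p" "sylow_pair (ch w) (sS w) (sT w)" using ch v w by auto
    have "orbit_le (chain_orbit G (ch v)) (chain_orbit G (ch w))" using le ch v w by metis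
    then obtain g where g: "g \<in> carrier G" "conj_chain G g (ch v) \<subseteq> ch w"
      using orbit_le_chain_orbit_iff[OF cv(1) cw(1)] by blast
    \<comment> \<open>Comparability of orbits only places a conjugate of \<open>ch v\<close> inside
      \<open>ch w\<close>, so \<open>mon\<close> is applied to that conjugate with the conjugated
      Sylow pair, and \<open>eqv\<close> brings the result back to \<open>ch v\<close>.\<close>
    obtain h where h: "h \<in> carrier G"
      "conj_chain G h (F (conj_chain G g (ch v)) (conj_set G g (sS v)) (conj_set G g (sT v))) \<subseteq> F (ch w) (sS w) (sT w)"
      using mon[OF Ap_chains_conj_chain[OF g(1) cv(1)] cw(1) g(2) sylow_pair_conj[OF g(1) cv] cw(2)] by blast
    then have "conj_chain G (h \<otimes> g) (F (ch v) (sS v) (sT v)) \<subseteq> F (ch w) (sS w) (sT w)"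
      using eqv[OF g(1) cv] conj_chain_conj_chain[OF h(1) g(1) chain[OF cv]] by simp
    then show "orbit_le (?f F v) (?f F w)"
      using orbit_le_chain_orbit_iff[OF chain[OF cv] chain[OF cw]] h(1) g(1) by blast
  qed
  have le: "orbit_le (chain_orbit G c) (chain_orbit G d)"
    if "c \<in> Ap_chains G p" "d \<in> Ap_chains G p" "c \<subseteq> d" for c d
    using orbit_le_chain_orbit_iff[OF that(1,2)] conj_chain_one[OF that(1)] that(3) by (metis one_closed)
  have m1: "mono_map ?X orbit_le (?f add_sylow)" by (rule mono) (rule add_sylow_chain add_sylow_conj add_sylow_mono; assumption)+
  have m2: "mono_map ?X orbit_le (?f keep_full)" by (rule mono) (rule keep_full_chain keep_full_conj keep_full_mono; assumption)+
  have m3: "mono_map ?X orbit_le (?f add_omega)"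
  proof (rule mono)
    show "add_omega (conj_chain G g c) (conj_set G g S) (conj_set G g T) = conj_chain G g (add_omega c S T)"
      if "g \<in> carrier G" "c \<in> Ap_chains G p" "sylow_pair c S T" for g c S T
      using add_omega_conj[OF that(1,2) maxp_subset] that(3) unfolding sylow_pair_def by blast
  qed (rule add_omega_chain[OF _ _ dvd] add_omega_mono; assumption)+
  obtain T0 where T0: "maxp (carrier G) T0" using maxp_exists[OF psub_one, of "carrier G"] by auto
  have single: "{omega T} \<in> Ap_chains G p" if "maxp (carrier G) T" for T
    using omega_Ap[OF dvd that] by (auto simp: Ap_chains_def)
  let ?a = "chain_orbit G {omega T0}"
  have m0: "mono_map ?X orbit_le (\<lambda>_. ?a)"
    unfolding mono_map_def using orb[OF single[OF T0]] le[OF single[OF T0] single[OF T0]] by auto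
  have mid: "mono_map ?X orbit_le id" by (simp add: mono_map_def)
  let ?h = "homotopic_with (\<lambda>_. True) (downset_space ?X orbit_le) (downset_space ?X orbit_le)"
  \<comment> \<open>The zigzag is \<open>id \<le> add_sylow \<ge> keep_full \<le> add_omega \<ge>
    const\<close>, the constant being the orbit of \<open>{omega T0}\<close>.\<close>
  have "?h id (?f add_sylow)"
  proof (rule mono_maps_homotopic[OF mid m1])
    fix w assume "w \<in> ?X"
    then have w: "ch w \<in> Ap_chains G p" "w = chain_orbit G (ch w)" "sylow_pair (ch w) (sS w) (sT w)" using ch by auto
    have "orbit_le (chain_orbit G (ch w)) (?f add_sylow w)"
      by (rule le[OF w(1) add_sylow_chain[OF w(1,3)]]) (auto simp: add_sylow_def)
    then show "orbit_le (id w) (?f add_sylow w)" using w(2) by simp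
  qed
  moreover have "?h (?f keep_full) (?f add_sylow)"
  proof (rule mono_maps_homotopic[OF m2 m1])
    fix w assume "w \<in> ?X"
    then have w: "ch w \<in> Ap_chains G p" "sylow_pair (ch w) (sS w) (sT w)" using ch by auto
    show "orbit_le (?f keep_full w) (?f add_sylow w)"
      by (rule le[OF keep_full_chain[OF w] add_sylow_chain[OF w]]) (use full_part_subset in \<open>auto simp: add_sylow_def keep_full_def\<close>)
  qed
  moreover have "?h (?f keep_full) (?f add_omega)"
  proof (rule mono_maps_homotopic[OF m2 m3])
    fix w assume "w \<in> ?X"
    then have w: "ch w \<in> Ap_chains G p" "sylow_pair (ch w) (sS w) (sT w)" using ch by auto
    show "orbit_le (?f keep_full w) (?f add_omega w)"
      by (rule le[OF keep_full_chain[OF w] add_omega_chain[OF w dvd]]) (auto simp: add_omega_def)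
  qed
  moreover have "?h (\<lambda>_. ?a) (?f add_omega)"
  proof (rule mono_maps_homotopic[OF m0 m3])
    fix w assume "w \<in> ?X"
    then have w: "ch w \<in> Ap_chains G p" "sylow_pair (ch w) (sS w) (sT w)" using ch by auto
    have T: "maxp (carrier G) (sT w)" using w by (simp add: sylow_pair_def)
    \<comment> \<open>All Sylow subgroups are conjugate, so whichever \<open>omega (sT w)\<close> is
      inserted, its orbit is that of \<open>omega T0\<close>.\<close>
    obtain g where g: "g \<in> carrier G" "conj_set G g T0 = sT w" using maxp_conj[OF subgroup_self T0 T] by blast
    have "conj_chain G g {omega T0} \<subseteq> add_omega (ch w) (sS w) (sT w)"
      using omega_conj_set[OF g(1) maxp_subset[OF T0]] g(2) by (simp add: conj_chain_def add_omega_def)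
    then show "orbit_le ?a (?f add_omega w)"
      using orbit_le_chain_orbit_iff[OF single[OF T0] add_omega_chain[OF w dvd]] g(1) by blast
  qed
  ultimately have "?h id (\<lambda>_. ?a)"
    by (meson homotopic_with_sym homotopic_with_trans)
  then show ?thesis unfolding contractible_space_def os by (rule exI)
qed

end

section \<open>From the rank bound to subgroups of index at most p\<close>

lemma (in finite_group_prime) p_rank_witness:
  "\<exists>A. elem_abelian G p A \<and> card A = p ^ p_rank G p (carrier G)"
proof -
  let ?R = "{r. \<exists>E. E \<subseteq> carrier G \<and> elem_abelian G p E \<and> card E = p ^ r}"
  have "elem_abelian G p {\<one>}" by (simp add: elem_abelian_def triv_subgroup)
  then have "0 \<in> ?R" by (intro CollectI exI[of _ "{\<one>}"]) simp
  moreover have "finite ?R"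
  proof (rule finite_subset)
    show "?R \<subseteq> {..card (carrier G)}"
    proof
      fix r assume "r \<in> ?R"
      then obtain E where "E \<subseteq> carrier G" "card E = p ^ r" by auto
      then have "p ^ r \<le> card (carrier G)" using card_mono[OF fin] by metis
      \<comment> \<open>Bounding the exponent itself by the group order makes the set of ranks
        finite, so that \<open>Max\<close> is attained.\<close>
      moreover have "r < p ^ r" using power_gt_expt[of p r] prime_gt_1_nat[OF p] by simp
      ultimately show "r \<in> {..card (carrier G)}" by simp
    qed
  qed simp
  ultimately have "Max ?R \<in> ?R" using Max_in[of ?R] by blast
  then show ?thesis unfolding p_rank_def by blast
qed

theorem theorem5p16:
  fixes G :: "('a, 'b) monoid_scheme" and p :: nat and P :: "'a set"
  assumes "group G" and "finite (carrier G)"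
    and "prime p" and "p dvd order G"
    and "sylow_subgroup G p P"
    and "int (p_rank G p (carrier G)) - int (p_rank G p (Omega1 G p (centre_of G P))) \<le> 2"
    and "real (p_rank G p (carrier G)) \<ge> log (real p) (real (card P)) - 1"
  shows "contractible_space (orbit_space G p)"
proof -
  interpret finite_group_prime G p
    using assms by (simp add: finite_group_prime_def finite_group_prime_axioms_def)
  have P: "maxp (carrier G) P" by (rule sylow_subgroup_maxp[OF assms(5)])
  define r where "r = p_rank G p (carrier G)"
  define n where "n = multiplicity p (order G)"
  have cP: "card P = p ^ n" using assms(5) by (simp add: sylow_subgroup_def n_def)
  have p1: "1 < p" using p by (rule prime_gt_1_nat)
  have "log (real p) (real (card P)) = real n" using cP p1 by (simp add: log_pow_cancel)
  \<comment> \<open>With \<open>card P = p ^ n\<close> the logarithmic bound becomes one on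
    exponents.\<close>
  then have rn: "n \<le> r + 1" using assms(7) by (simp add: r_def)
  obtain A where A: "elem_abelian G p A" "card A = p ^ r" using p_rank_witness by (auto simp: r_def)
  interpret index_p_sylow G p
  proof
    fix T assume T: "maxp (carrier G) T"
    obtain g where g: "g \<in> carrier G" "conj_set G g P = T" using maxp_conj[OF subgroup_self P T] by blast
    then have cT: "card T = p ^ n" using card_conj_set[OF g(1) maxp_subset[OF P]] cP by simp
    \<comment> \<open>A subgroup attaining the rank of the whole group can be conjugated into
      \<open>T\<close>; there its index is \<open>p ^ (n - r)\<close>, which is 1 or
      \<open>p\<close>.\<close>
    obtain h where h: "h \<in> carrier G" "conj_set G h A \<subseteq> T"
      using maxp_conj_into[OF subgroup_self T elem_abelian_psub[OF A(1)] elem_abelian_carrier[OF A(1)]] by blast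
    have cA: "card (conj_set G h A) = p ^ r"
      using card_conj_set[OF h(1) elem_abelian_carrier[OF A(1)]] A(2) by simp
    have "p ^ r \<le> p ^ n"
      using card_mono[OF psub_finite[OF maxp_psub[OF T]] h(2)] cA cT by simp
    then have "r \<le> n" using power_le_imp_le_exp[OF p1] by blast
    then have "n = r \<or> n = Suc r" using rn by linarith
    then show "\<exists>A. elem_abelian G p A \<and> A \<subseteq> T \<and> (card T = card A \<or> card T = p * card A)"
      using elem_abelian_conj_set[OF h(1) A(1)] h(2) cA cT by (intro exI[of _ "conj_set G h A"]) auto
  qed
  show ?thesis by (rule orbit_space_contractible[OF assms(4)])
qed

end
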